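(* Let $X\sim(B,\sigma^2,\gamma)$ with $\mathcal{G}(B)$ a directed acyclic graph of maximum in-degree at most $q$, where $q$ is an integer with $0\le q\le p-1$. Suppose all $(q+1)\times(q+1)$ principal submatrices of $\Sigma=\mathbb{E}(XX^T)$ have minimum eigenvalue at least $\lambda_{\min}>0$. Let $\epsilon>0$ and let $\hat\Sigma$ be the sample covariance matrix of $n$ i.i.d. copies of $X$. If $$ n\;>\;(q+1)^2\left\{\log(p^2+p)-\log(\epsilon/2)\right\}\,128\left(1+4\frac{\gamma^2}{\sigma^2}\right)^2\left(\max_{j\in V}\Sigma_{j,j}\right)^2\left(\frac{\zeta\lambda_{\min}+2\sigma^2}{\zeta\lambda_{\min}^2}\right)^2, $$ then the Topological Ordering algorithm with input $\hat\Sigma$ and criterion $$ f_2(\hat\Sigma,\Theta,j)=\min_{C\subseteq\Theta,\ |C|=\min(q,|\Theta|)}\left\{\hat\Sigma_{j,j}-\hat\Sigma_{j,C}(\hat\Sigma_{C,C})^{-1}\hat\Sigma_{C,j}\right\} $$ outputs a topological ordering of $\mathcal{G}(B)$ with probability at least $1-\epsilon$.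
   Context: Model. Let $V=\{1,\dots,p\}$. For a real $p\times p$ matrix $B=(\beta_{jk})$ with zero diagonal and $\sigma^2>0$, write $X\sim(B,\sigma^2)$ if the random vector $X=(X_1,\dots,X_p)$ solves $X_j=\sum_{k\neq j}\beta_{jk}X_k+\varepsilon_j$, $j=1,\dots,p$, for independent mean-zero random variables $\varepsilon_1,\dots,\varepsilon_p$ all having the same variance $\sigma^2$. Write $X\sim(B,\sigma^2,\gamma)$ if in addition each $\varepsilon_j$ is sub-Gaussian with parameter at most $\gamma>0$, i.e. $\mathbb{E}\,e^{t\varepsilon_j}\le e^{\gamma^2t^2/2}$ for all $t\in\mathbb{R}$. Graph. $\mathcal{G}(B)$ is the directed graph with vertex set $V$ and edge set $E(B)=\{(k,j):\beta_{jk}\neq 0\}$, where $(k,j)$ is the edge $k\to j$. The in-degree of $j$ is the number of edges $k\to j$. Define $\zeta=\min_{(k,j)\in E(B)}\beta_{jk}^2$ (if $E(B)=\emptyset$, $\zeta$ may be taken to be any positive number). An ordering $(\theta_1,\dots,\theta_p)$ of $V$ is a topological ordering of $\mathcal{G}(B)$ if for every edge $k\to j$, $k$ appears before $j$ in the ordering. Sample covariance. For i.i.d. copies $X^{(1)},\dots,X^{(n)}$ of $X$ (which is centered), $\hat\Sigma=\frac1n\sum_{i=1}^n X^{(i)}(X^{(i)})^T$. Topological Ordering algorithm with criterion $f$ and input $\hat\Sigma$: set $\Theta^{(0)}=\emptyset$. For $z=1,\dots,p$, choose $\theta_z\in\arg\min_{j\in V\setminus\Theta^{(z-1)}} f(\hat\Sigma,\Theta^{(z-1)},j)$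 (ties broken arbitrarily) and set $\Theta^{(z)}=\Theta^{(z-1)}\cup\{\theta_z\}$. Output the ordered list $(\theta_1,\dots,\theta_p)$. For $C=\emptyset$, the expression $\hat\Sigma_{j,j}-\hat\Sigma_{j,C}(\hat\Sigma_{C,C})^{-1}\hat\Sigma_{C,j}$ is $\hat\Sigma_{j,j}$. If a matrix to be inverted is singular, the criterion may be given an arbitrary value. Subscripts denote submatrices. *)

theory Defs
  imports
    "HOL-Probability.Probability"
    "Jordan_Normal_Form.DL_Submatrix"
    "Jordan_Normal_Form.Gauss_Jordan_Elimination"
    "Jordan_Normal_Form.Spectral_Radius"
begin

text \<open>
  The vertex set is \<open>V = {..<p}\<close> (0-based). Coefficient and covariance matrices are
  \<open>p \<times> p\<close> matrices over the reals; a random vector indexed by \<open>V\<close> is a measurable map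
  into the product space \<open>\<Pi>\<^sub>M j\<in>{..<p}. borel\<close>.
\<close>

abbreviation vec_space :: "nat \<Rightarrow> (nat \<Rightarrow> real) measure" where
  "vec_space p \<equiv> \<Pi>\<^sub>M j\<in>{..<p}. borel"


subsection \<open>Linear structural equation models with equal error variances\<close>

text \<open>
  Integrability is demanded explicitly, since the Bochner integral of a
  non-integrable function is \<open>0\<close> and the bounds would then hold vacuously.
\<close>

definition (in prob_space) sub_gaussian :: "real \<Rightarrow> ('a \<Rightarrow> real) \<Rightarrow> bool" where
  "sub_gaussian \<gamma> Z \<longleftrightarrow>
     (\<forall>t. integrable M (\<lambda>\<omega>. exp (t * Z \<omega>)) \<and>
          expectation (\<lambda>\<omega>. exp (t * Z \<omega>)) \<le> exp (\<gamma>\<^sup>2 * t\<^sup>2 / 2))"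

definition (in prob_space) equal_variance_noise :: "nat \<Rightarrow> real \<Rightarrow> (nat \<Rightarrow> 'a \<Rightarrow> real) \<Rightarrow> bool" where
  "equal_variance_noise p \<sigma> e \<longleftrightarrow>
     indep_vars (\<lambda>_. borel) e {..<p} \<and>
     (\<forall>j<p. integrable M (e j) \<and> expectation (e j) = 0 \<and>
            integrable M (\<lambda>\<omega>. (e j \<omega>)\<^sup>2) \<and> variance (e j) = \<sigma>\<^sup>2)"

definition (in prob_space) solves_sem ::
    "nat \<Rightarrow> real mat \<Rightarrow> (nat \<Rightarrow> 'a \<Rightarrow> real) \<Rightarrow> ('a \<Rightarrow> nat \<Rightarrow> real) \<Rightarrow> bool" where
  "solves_sem p B e X \<longleftrightarrow>
     random_variable (vec_space p) X \<and>
     (\<forall>j<p. AE \<omega> in M. X \<omega> j = (\<Sum>k\<in>{..<p} - {j}. B $$ (j, k) * X \<omega> k) + e j \<omega>)"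

text \<open>\<open>X \<sim> (B, \<sigma>\<^sup>2, \<gamma>)\<close>; the entry \<open>\<beta>\<^sub>j\<^sub>k\<close> is \<open>B $$ (j, k)\<close>.\<close>

definition (in prob_space) equal_variance_sem ::
    "nat \<Rightarrow> real mat \<Rightarrow> real \<Rightarrow> real \<Rightarrow> ('a \<Rightarrow> nat \<Rightarrow> real) \<Rightarrow> bool" where
  "equal_variance_sem p B \<sigma> \<gamma> X \<longleftrightarrow>
     B \<in> carrier_mat p p \<and> (\<forall>j<p. B $$ (j, j) = 0) \<and> 0 < \<sigma> \<and> 0 < \<gamma> \<and>
     (\<exists>e. equal_variance_noise p \<sigma> e \<and> (\<forall>j<p. sub_gaussian \<gamma> (e j)) \<and> solves_sem p B e X)"

definition (in prob_space) second_moment_mat :: "nat \<Rightarrow> ('a \<Rightarrow> nat \<Rightarrow> real) \<Rightarrow> real mat" where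
  "second_moment_mat p X = mat p p (\<lambda>(j, k). expectation (\<lambda>\<omega>. X \<omega> j * X \<omega> k))"

definition min_eigenvalue :: "real mat \<Rightarrow> real" where
  "min_eigenvalue A = Min (spectrum A)"


subsection \<open>The graph of a coefficient matrix\<close>

text \<open>The pair \<open>(k, j)\<close> is the edge \<open>k \<rightarrow> j\<close>, present iff \<open>\<beta>\<^sub>j\<^sub>k \<noteq> 0\<close>.\<close>

definition edges :: "nat \<Rightarrow> real mat \<Rightarrow> (nat \<times> nat) set" where
  "edges p B = {(k, j). k < p \<and> j < p \<and> B $$ (j, k) \<noteq> 0}"

definition in_deg :: "nat \<Rightarrow> real mat \<Rightarrow> nat \<Rightarrow> nat" where
  "in_deg p B j = card {k. (k, j) \<in> edges p B}"

text \<open>For an edgeless graph any positive number is admissible.\<close>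

definition is_min_edge_strength :: "nat \<Rightarrow> real mat \<Rightarrow> real \<Rightarrow> bool" where
  "is_min_edge_strength p B \<zeta> \<longleftrightarrow>
     (if edges p B = {} then 0 < \<zeta>
      else \<zeta> = Min ((\<lambda>(k, j). (B $$ (j, k))\<^sup>2) ` edges p B))"

definition topological_ordering :: "nat \<Rightarrow> real mat \<Rightarrow> nat list \<Rightarrow> bool" where
  "topological_ordering p B \<theta> \<longleftrightarrow>
     distinct \<theta> \<and> set \<theta> = {..<p} \<and>
     (\<forall>(k, j)\<in>edges p B. \<exists>a b. a < b \<and> b < length \<theta> \<and> \<theta> ! a = k \<and> \<theta> ! b = j)"


subsection \<open>I.i.d. samples and the sample covariance matrix\<close>

text \<open>The copies \<open>Y 0, \<dots>, Y (n - 1)\<close> may live on a different probability space than \<open>X\<close>.\<close>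

definition (in prob_space) iid_copies ::
    "nat \<Rightarrow> nat \<Rightarrow> (nat \<Rightarrow> 'a \<Rightarrow> nat \<Rightarrow> real) \<Rightarrow> 'b measure \<Rightarrow> ('b \<Rightarrow> nat \<Rightarrow> real) \<Rightarrow> bool" where
  "iid_copies p n Y N X \<longleftrightarrow>
     indep_vars (\<lambda>_. vec_space p) Y {..<n} \<and>
     (\<forall>i<n. distr M (vec_space p) (Y i) = distr N (vec_space p) X)"

definition sample_cov :: "nat \<Rightarrow> nat \<Rightarrow> (nat \<Rightarrow> 'a \<Rightarrow> nat \<Rightarrow> real) \<Rightarrow> 'a \<Rightarrow> real mat" where
  "sample_cov p n Y \<omega> = mat p p (\<lambda>(j, k). (1 / real n) * (\<Sum>i<n. Y i \<omega> j * Y i \<omega> k))"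


subsection \<open>The Topological Ordering algorithm\<close>

definition cond_var :: "real mat \<Rightarrow> nat set \<Rightarrow> nat \<Rightarrow> real" where
  "cond_var S C j =
     S $$ (j, j) -
     (submatrix S {j} C * the (mat_inverse (submatrix S C C)) * submatrix S C {j}) $$ (0, 0)"

definition candidates :: "nat \<Rightarrow> nat set \<Rightarrow> nat set set" where
  "candidates q \<Theta> = {C. C \<subseteq> \<Theta> \<and> card C = min q (card \<Theta>)}"

text \<open>
  The criterion \<open>f\<^sub>2\<close>. The argument \<open>d\<close> supplies the arbitrary value taken when one of the
  matrices to be inverted is singular.
\<close>

definition crit_f2 ::
    "(real mat \<Rightarrow> nat set \<Rightarrow> nat \<Rightarrow> real) \<Rightarrow> nat \<Rightarrow> real mat \<Rightarrow> nat set \<Rightarrow> nat \<Rightarrow> real" where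
  "crit_f2 d q S \<Theta> j =
     (if \<forall>C\<in>candidates q \<Theta>. invertible_mat (submatrix S C C)
      then Min ((\<lambda>C. cond_var S C j) ` candidates q \<Theta>)
      else d S \<Theta> j)"

text \<open>
  With arbitrary tie-breaking the algorithm is a relation between its input and its
  possible outputs; \<open>set (take z \<theta>)\<close> is the set of vertices chosen in the first \<open>z\<close> steps.
\<close>

definition topological_ordering_output ::
    "nat \<Rightarrow> (real mat \<Rightarrow> nat set \<Rightarrow> nat \<Rightarrow> real) \<Rightarrow> real mat \<Rightarrow> nat list \<Rightarrow> bool" where
  "topological_ordering_output p f S \<theta> \<longleftrightarrow>
     length \<theta> = p \<and>
     (\<forall>z<p. is_arg_min (f S (set (take z \<theta>))) (\<lambda>j. j \<in> {..<p} - set (take z \<theta>)) (\<theta> ! z))"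


subsection \<open>Empty conditioning set\<close>

lemma cond_var_empty:
  assumes "S \<in> carrier_mat p p" "j < p"
  shows "cond_var S {} j = S $$ (j, j)"
proof -
  have dim: "submatrix S {} {} \<in> carrier_mat 0 0"
    by (simp add: submatrix_def)
  have "mat_inverse (submatrix S {} {}) \<noteq> None"
  proof
    assume "mat_inverse (submatrix S {} {}) = None"
    from mat_inverse(1)[OF dim this, of "()"]
    have "submatrix S {} {} \<notin> Units (ring_mat TYPE(real) 0 ())" .
    moreover have "submatrix S {} {} = 1\<^sub>m 0"
      using dim by (intro eq_matI) auto
    ultimately show False
      by (simp add: Units_def ring_mat_def)
  qed
  then obtain T where T: "mat_inverse (submatrix S {} {}) = Some T" by blast
  have Tc: "T \<in> carrier_mat 0 0"
    using mat_inverse(2)[OF dim T] by simp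
  have "{i. i < p \<and> i = j} = {j}" using assms by auto
  then have row: "submatrix S {j} {} \<in> carrier_mat 1 0" and col: "submatrix S {} {j} \<in> carrier_mat 0 1"
    using assms by (auto simp: submatrix_def)
  have "(submatrix S {j} {} * T * submatrix S {} {j}) $$ (0, 0) = 0"
    using row col Tc by (simp add: scalar_prod_def)
  then show ?thesis
    by (simp add: cond_var_def T)
qed

end

theory Submission
  imports Defs
begin

text \<open>
  The residual variance of \<open>X\<^sub>j\<close> given \<open>X\<^sub>C\<close> is the minimum of \<open>a\<^sup>T \<Sigma> a\<close> over vectors \<open>a\<close> supported on
  \<open>C \<union> {j}\<close> with \<open>a\<^sub>j = 1\<close>. If the vertices chosen so far form an ancestral set \<open>\<Theta>\<close>, this minimum is
  \<open>\<sigma>\<^sup>2\<close> for a suitable \<open>C\<close> when all parents of \<open>j\<close> lie in \<open>\<Theta>\<close>, and at least \<open>\<sigma>\<^sup>2 (1 + \<zeta>)\<close> for every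
  \<open>C\<close> otherwise. If the entries of the sample covariance are off by less than \<open>\<delta>\<close>, every form
  \<open>a\<^sup>T \<Sigma> a\<close> with support of size at most \<open>q + 1\<close> changes by a relative error less than
  \<open>\<eta> = (q + 1) \<delta> / \<lambda>\<close>. With \<open>\<eta> = \<zeta> \<lambda> / (\<zeta> \<lambda> + 2 \<sigma>\<^sup>2)\<close> and \<open>\<lambda> \<le> \<sigma>\<^sup>2\<close> one has
  \<open>1 + \<eta> \<le> (1 - \<eta>) (1 + \<zeta>)\<close>, so each step picks a vertex all of whose parents were already chosen.
  The entrywise deviation is controlled by a Chernoff bound for the products \<open>X\<^sub>j X\<^sub>k\<close>, whose moments
  are bounded by those of the sub-Gaussian variables \<open>X\<^sub>j\<close> and \<open>X\<^sub>k\<close>, and a union bound.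
\<close>

subsection \<open>Quadratic forms and the Rayleigh quotient\<close>

text \<open>Taken over an index set instead of a vector dimension, so that shrinking or padding the
  support of \<open>a\<close> needs no reindexing.\<close>

definition qform :: "('i \<Rightarrow> 'i \<Rightarrow> real) \<Rightarrow> 'i set \<Rightarrow> ('i \<Rightarrow> real) \<Rightarrow> real" where
  "qform s T a = (\<Sum>i\<in>T. \<Sum>k\<in>T. a i * s i k * a k)"

lemma qform_cong:
  assumes "\<And>i k. i \<in> T \<Longrightarrow> k \<in> T \<Longrightarrow> s i k = s' i k" "\<And>i. i \<in> T \<Longrightarrow> a i = a' i"
  shows "qform s T a = qform s' T a'"
  unfolding qform_def using assms by (intro sum.cong refl) auto

lemma qform_superset:
  assumes "finite T'" "T \<subseteq> T'" "\<And>i. i \<in> T' - T \<Longrightarrow> a i = 0"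
  shows "qform s T' a = qform s T a"
proof -
  have "(\<Sum>i\<in>T'. \<Sum>k\<in>T'. a i * s i k * a k) = (\<Sum>i\<in>T. \<Sum>k\<in>T'. a i * s i k * a k)"
    using assms by (intro sum.mono_neutral_right) auto
  also have "\<dots> = (\<Sum>i\<in>T. \<Sum>k\<in>T. a i * s i k * a k)"
    using assms by (intro sum.cong refl sum.mono_neutral_right) auto
  finally show ?thesis by (simp add: qform_def)
qed

lemma qform_scale: "qform s T (\<lambda>i. c * a i) = c\<^sup>2 * qform s T a"
  unfolding qform_def sum_distrib_left
  by (intro sum.cong refl) (simp add: power2_eq_square algebra_simps)

lemma qform_diff: "qform (\<lambda>i k. s i k - s' i k) T a = qform s T a - qform s' T a"
  by (simp add: qform_def sum_subtractf algebra_simps)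

text \<open>Symmetry merges the two cross terms. They are grouped as \<open>b\<close> against
  \<open>s a\<close> because \<open>s a\<close> is explicitly known in the applications.\<close>

lemma qform_add:
  assumes sym: "\<And>i k. i \<in> T \<Longrightarrow> k \<in> T \<Longrightarrow> s i k = s k i"
  shows "qform s T (\<lambda>i. a i + b i) = qform s T a + 2 * (\<Sum>i\<in>T. b i * (\<Sum>k\<in>T. s i k * a k)) + qform s T b"
proof -
  have "(\<Sum>i\<in>T. \<Sum>k\<in>T. a i * s i k * b k) = (\<Sum>k\<in>T. \<Sum>i\<in>T. a i * s i k * b k)"
    by (rule sum.swap)
  also have "\<dots> = (\<Sum>k\<in>T. \<Sum>i\<in>T. b k * s k i * a i)"
    using sym by (intro sum.cong refl) simp
  finally show ?thesis
    by (simp add: qform_def sum_distrib_left sum.distrib algebra_simps)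
qed

text \<open>Arithmetic-geometric mean inequality in each entry. Every square then occurs
  \<open>card T\<close> times, which is the origin of the factor \<open>q + 1\<close> in the sample
  size.\<close>

lemma abs_qform_le:
  assumes "finite T" "\<And>i k. i \<in> T \<Longrightarrow> k \<in> T \<Longrightarrow> \<bar>s i k\<bar> \<le> \<delta>" "0 \<le> \<delta>"
  shows "\<bar>qform s T a\<bar> \<le> real (card T) * \<delta> * (\<Sum>i\<in>T. (a i)\<^sup>2)"
proof -
  have "\<bar>qform s T a\<bar> \<le> (\<Sum>i\<in>T. \<Sum>k\<in>T. \<bar>a i * s i k * a k\<bar>)"
    unfolding qform_def by (rule order_trans[OF sum_abs], rule sum_mono, rule sum_abs)
  also have "\<dots> \<le> (\<Sum>i\<in>T. \<Sum>k\<in>T. \<delta> * ((a i)\<^sup>2 + (a k)\<^sup>2) / 2)"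
  proof (intro sum_mono)
    fix i k assume "i \<in> T" "k \<in> T"
    have "0 \<le> (\<bar>a i\<bar> - \<bar>a k\<bar>)\<^sup>2" by simp
    then have "\<bar>a i\<bar> * \<bar>a k\<bar> \<le> ((a i)\<^sup>2 + (a k)\<^sup>2) / 2"
      by (simp add: power2_diff)
    then have "\<bar>s i k\<bar> * (\<bar>a i\<bar> * \<bar>a k\<bar>) \<le> \<delta> * (((a i)\<^sup>2 + (a k)\<^sup>2) / 2)"
      using assms \<open>i \<in> T\<close> \<open>k \<in> T\<close> by (intro mult_mono) auto
    then show "\<bar>a i * s i k * a k\<bar> \<le> \<delta> * ((a i)\<^sup>2 + (a k)\<^sup>2) / 2"
      by (simp add: abs_mult mult_ac)
  qed
  also have "\<dots> = real (card T) * \<delta> * (\<Sum>i\<in>T. (a i)\<^sup>2)"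
    by (simp add: sum_divide_distrib[symmetric] sum_distrib_left[symmetric] sum.distrib sum_distrib_right[symmetric])
  finally show ?thesis .
qed

text \<open>Minimizing the form along the line through \<open>a\<close> in the direction \<open>s\<^sup>-\<^sup>1 a\<close>
  replaces a compactness argument.\<close>
lemma nonneg_qform_coercive:
  fixes s w :: "nat \<Rightarrow> nat \<Rightarrow> real"
  assumes sym: "\<And>i k. i < m \<Longrightarrow> k < m \<Longrightarrow> s i k = s k i"
    and nonneg: "\<And>a. 0 \<le> qform s {..<m} a"
    and inv: "\<And>i k. i < m \<Longrightarrow> k < m \<Longrightarrow> (\<Sum>l<m. s i l * w l k) = (if i = k then 1 else 0)"
  obtains c where "0 < c" "\<And>a. c * (\<Sum>i<m. (a i)\<^sup>2) \<le> qform s {..<m} a"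
proof
  define K where "K = (\<Sum>i<m. \<Sum>k<m. \<bar>w i k\<bar>)"
  define D where "D = 1 + real m * K"
  have K0: "0 \<le> K" unfolding K_def by (intro sum_nonneg) auto
  then have D: "0 < D" by (simp add: D_def add_pos_nonneg)
  then show "0 < 1 / D" by simp
  fix a :: "nat \<Rightarrow> real"
  define R where "R = (\<Sum>i<m. (a i)\<^sup>2)"
  define y where "y l = (\<Sum>k<m. w l k * a k)" for l
  have sy: "(\<Sum>l<m. s i l * y l) = a i" if "i < m" for i
  proof -
    have "(\<Sum>l<m. s i l * y l) = (\<Sum>l<m. \<Sum>k<m. s i l * w l k * a k)"
      by (simp add: y_def sum_distrib_left mult_ac)
    also have "\<dots> = (\<Sum>k<m. \<Sum>l<m. s i l * w l k * a k)" by (rule sum.swap)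
    also have "\<dots> = (\<Sum>k<m. (if i = k then 1 else 0) * a k)"
      using inv[OF that] by (intro sum.cong refl) (simp add: sum_distrib_right[symmetric])
    also have "\<dots> = (\<Sum>k<m. if i = k then a k else 0)" by (intro sum.cong refl) simp
    also have "\<dots> = a i" using that by simp
    finally show ?thesis .
  qed
  have ay: "qform s {..<m} y = qform w {..<m} a"
  proof -
    have "qform s {..<m} y = (\<Sum>i<m. y i * (\<Sum>k<m. s i k * y k))"
      by (simp add: qform_def sum_distrib_left mult_ac)
    also have "\<dots> = (\<Sum>i<m. y i * a i)" using sy by simp
    also have "\<dots> = qform w {..<m} a"
      by (simp add: qform_def y_def sum_distrib_left sum_distrib_right mult_ac)
    finally show ?thesis .
  qed
  have "qform w {..<m} a \<le> real m * K * R"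
  proof -
    have "\<bar>w i k\<bar> \<le> K" if "i < m" "k < m" for i k
    proof -
      have "\<bar>w i k\<bar> \<le> (\<Sum>k<m. \<bar>w i k\<bar>)"
        using that by (intro member_le_sum) auto
      also have "\<dots> \<le> K" unfolding K_def
        using that by (intro member_le_sum[of i "{..<m}" "\<lambda>i. \<Sum>k<m. \<bar>w i k\<bar>"]) (auto intro: sum_nonneg)
      finally show ?thesis .
    qed
    then have "\<bar>qform w {..<m} a\<bar> \<le> real (card {..<m}) * K * R"
      unfolding R_def using K0 by (intro abs_qform_le) auto
    then show ?thesis by simp
  qed
  also have "\<dots> \<le> D * R" by (simp add: D_def R_def algebra_simps sum_nonneg)
  finally have wR: "qform w {..<m} a \<le> D * R" .
  \<comment> \<open>Move from \<open>a\<close> by \<open>- y / D\<close>, where \<open>y\<close> is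
    \<open>s\<^sup>-\<^sup>1 a\<close>. The cross term is \<open>- 2 * R / D\<close> and the
    quadratic term at most \<open>R / D\<close>, so nonnegativity leaves at least
    \<open>R / D\<close> for the form at \<open>a\<close>.\<close>
  have "0 \<le> qform s {..<m} (\<lambda>i. (- 1 / D) * y i + a i)" by (rule nonneg)
  also have "\<dots> = (- 1 / D)\<^sup>2 * qform s {..<m} y
      + 2 * (\<Sum>i<m. a i * (\<Sum>k<m. s i k * ((- 1 / D) * y k))) + qform s {..<m} a"
    using sym by (subst qform_add) (simp_all only: qform_scale lessThan_iff)
  also have "(\<Sum>i<m. a i * (\<Sum>k<m. s i k * ((- 1 / D) * y k))) = - (1 / D) * R"
  proof -
    have "(\<Sum>k<m. s i k * ((- 1 / D) * y k)) = - (1 / D) * a i" if "i < m" for i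
      by (subst sy[OF that, symmetric]) (simp add: sum_distrib_left mult_ac)
    then show ?thesis
      by (simp add: R_def sum_distrib_left power2_eq_square mult_ac)
  qed
  finally have "2 * R / D \<le> (1 / D)\<^sup>2 * qform w {..<m} a + qform s {..<m} a"
    by (simp add: ay)
  also have "(1 / D)\<^sup>2 * qform w {..<m} a \<le> (1 / D)\<^sup>2 * (D * R)"
    by (intro mult_left_mono wR) auto
  also have "\<dots> = R / D" using D by (simp add: power2_eq_square)
  finally show "1 / D * (\<Sum>i<m. (a i)\<^sup>2) \<le> qform s {..<m} a"
    by (simp add: R_def)
qed

lemma det_nonzero_inverse:
  fixes A :: "'a::field mat"
  assumes A: "A \<in> carrier_mat m m" and "det A \<noteq> 0"
  obtains W where "W \<in> carrier_mat m m" "A * W = 1\<^sub>m m" "W * A = 1\<^sub>m m"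
  using det_non_zero_imp_unit[OF assms, of "()"] A
  by (auto simp: Units_def ring_mat_def)

lemma index_mult_mat_sum:
  assumes "A \<in> carrier_mat l m" "W \<in> carrier_mat m n" "i < l" "k < n"
  shows "(A * W) $$ (i, k) = (\<Sum>j<m. A $$ (i, j) * W $$ (j, k))"
  using assms by (auto simp: scalar_prod_def atLeast0LessThan intro!: sum.cong)

text \<open>The infimum \<open>\<mu>\<close> of the form over unit vectors is an eigenvalue:
  otherwise \<open>A\<close> minus \<open>\<mu>\<close> times the identity would be invertible with
  a nonnegative form, hence coercive by \<open>nonneg_qform_coercive\<close>, and the infimum would
  exceed \<open>\<mu>\<close>. The least element of the spectrum is then at most
  \<open>\<mu>\<close>.\<close>

lemma min_eigenvalue_le_qform:
  assumes A: "A \<in> carrier_mat m m" and m: "0 < m"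
    and sym: "\<And>i k. i < m \<Longrightarrow> k < m \<Longrightarrow> A $$ (i, k) = A $$ (k, i)"
  shows "min_eigenvalue A * (\<Sum>i<m. (a i)\<^sup>2) \<le> qform (\<lambda>i k. A $$ (i, k)) {..<m} a"
proof -
  let ?q = "qform (\<lambda>i k. A $$ (i, k)) {..<m}"
  let ?N = "\<lambda>a::nat \<Rightarrow> real. \<Sum>i<m. (a i)\<^sup>2"
  define S where "S = ?q ` {a. ?N a = 1}"
  define \<mu> where "\<mu> = Inf S"
  define L where "L = (\<Sum>i<m. \<Sum>k<m. \<bar>A $$ (i, k)\<bar>)"
  have L: "\<bar>A $$ (i, k)\<bar> \<le> L" if "i < m" "k < m" for i k
  proof -
    have "\<bar>A $$ (i, k)\<bar> \<le> (\<Sum>k<m. \<bar>A $$ (i, k)\<bar>)"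
      using that by (intro member_le_sum) auto
    also have "\<dots> \<le> L" unfolding L_def
      using that by (intro member_le_sum[of i "{..<m}" "\<lambda>i. \<Sum>k<m. \<bar>A $$ (i, k)\<bar>"]) (auto intro: sum_nonneg)
    finally show ?thesis .
  qed
  have L0: "0 \<le> L" unfolding L_def by (intro sum_nonneg) auto
  have bdd: "bdd_below S"
  proof (rule bdd_belowI)
    fix x assume "x \<in> S"
    then obtain a where a: "x = ?q a" "?N a = 1" by (auto simp: S_def)
    have "\<bar>?q a\<bar> \<le> real (card {..<m}) * L * ?N a"
      using L L0 by (intro abs_qform_le) auto
    then show "- (real m * L) \<le> x" using a by simp
  qed
  \<comment> \<open>A unit vector exists because \<open>0 < m\<close>; over an empty
    \<open>S\<close> the infimum would be unspecified.\<close>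
  define a0 :: "nat \<Rightarrow> real" where "a0 i = (if i = 0 then 1 else 0)" for i
  have "?N a0 = (\<Sum>i<m. if i = 0 then 1 else 0)"
    by (intro sum.cong refl) (simp add: a0_def)
  also have "\<dots> = 1" using m by simp
  finally have "?q a0 \<in> S" unfolding S_def by (intro imageI CollectI)
  then have ne: "S \<noteq> {}" by (rule ex_in_conv[THEN iffD1, OF exI])
  have lower: "\<mu> * ?N a \<le> ?q a" for a
  proof (cases "?N a = 0")
    case True
    then have "a i = 0" if "i < m" for i
      using that by (simp add: sum_nonneg_eq_0_iff)
    then have "?q a = 0" by (simp add: qform_def)
    with True show ?thesis by simp
  next
    case False
    define r where "r = sqrt (?N a)"
    have N0: "0 < ?N a" using False by (simp add: less_le sum_nonneg)
    then have r: "r\<^sup>2 = ?N a" "r > 0" by (auto simp: r_def)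
    have "?N (\<lambda>i. (1 / r) * a i) = (1 / r)\<^sup>2 * ?N a"
      by (simp only: power_mult_distrib sum_distrib_left)
    also have "\<dots> = 1" using r by (simp add: power_divide flip: r(1))
    finally have "?q (\<lambda>i. (1 / r) * a i) \<in> S" by (simp add: S_def)
    then have "\<mu> \<le> (1 / r)\<^sup>2 * ?q a"
      unfolding \<mu>_def qform_scale[symmetric] using bdd by (rule cInf_lower)
    then have "\<mu> \<le> ?q a / r\<^sup>2" by (simp add: power_divide)
    then show ?thesis using N0 by (simp add: r field_simps)
  qed
  have "eigenvalue A \<mu>"
  proof (rule ccontr)
    assume "\<not> eigenvalue A \<mu>"
    then have "det (char_matrix A \<mu>) \<noteq> 0" by (simp add: eigenvalue_det[OF A])
    moreover have cA: "char_matrix A \<mu> \<in> carrier_mat m m" using A by simp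
    ultimately obtain W where W: "W \<in> carrier_mat m m" "char_matrix A \<mu> * W = 1\<^sub>m m"
      using det_nonzero_inverse by blast
    let ?s = "\<lambda>i k. char_matrix A \<mu> $$ (i, k)"
    have s: "?s i k = A $$ (i, k) - \<mu> * (if i = k then 1 else 0)" if "i < m" "k < m" for i k
      using A that by (simp add: char_matrix_def)
    have qs: "qform ?s {..<m} a = ?q a - \<mu> * ?N a" for a
    proof -
      have "qform ?s {..<m} a = qform (\<lambda>i k. A $$ (i, k) - \<mu> * (if i = k then 1 else 0)) {..<m} a"
        using s by (intro qform_cong) auto
      also have "\<dots> = ?q a - (\<Sum>i<m. \<Sum>k<m. a i * (\<mu> * (if i = k then 1 else 0)) * a k)"
        by (simp add: qform_diff) (simp add: qform_def)
      also have "(\<Sum>i<m. \<Sum>k<m. a i * (\<mu> * (if i = k then 1 else 0)) * a k)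
          = (\<Sum>i<m. \<Sum>k<m. if i = k then \<mu> * (a i)\<^sup>2 else 0)"
        by (intro sum.cong refl) (simp add: power2_eq_square)
      also have "\<dots> = \<mu> * ?N a" by (simp add: sum_distrib_left)
      finally show ?thesis .
    qed
    obtain c where c: "0 < c" "\<And>a. c * ?N a \<le> qform ?s {..<m} a"
    proof (rule nonneg_qform_coercive)
      show "?s i k = ?s k i" if "i < m" "k < m" for i k
        using sym[OF that] by (simp add: s that)
      show "0 \<le> qform ?s {..<m} a" for a using lower[of a] by (simp add: qs)
      show "(\<Sum>l<m. ?s i l * W $$ (l, k)) = (if i = k then 1 else 0)" if "i < m" "k < m" for i k
        using index_mult_mat_sum[OF cA W(1) that] that by (simp add: W(2))
    qed (rule that)
    have "\<mu> + c \<le> Inf S"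
    proof (rule cInf_greatest[OF ne])
      fix x assume "x \<in> S"
      then obtain a where a: "x = ?q a" "?N a = 1" by (auto simp: S_def)
      show "\<mu> + c \<le> x" using c(2)[of a] a by (simp add: qs)
    qed
    with c(1) show False by (simp add: \<mu>_def)
  qed
  then have "min_eigenvalue A \<le> \<mu>"
    unfolding min_eigenvalue_def using card_finite_spectrum(1)[OF A]
    by (intro Min_le) (auto simp: spectrum_def)
  then have "min_eigenvalue A * ?N a \<le> \<mu> * ?N a"
    by (intro mult_right_mono) (auto intro: sum_nonneg)
  also note lower
  finally show ?thesis .
qed


subsection \<open>Conditional variances as minima\<close>

text \<open>\<open>pick C\<close> lists \<open>C\<close> in increasing order and its inverse counts
  the smaller elements. Sums over submatrix positions thereby become sums over vertices.\<close>

lemma bij_betw_pick: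
  assumes "finite C"
  shows "bij_betw (pick C) {..<card C} C"
proof (rule bij_betwI)
  show "pick C \<in> {..<card C} \<rightarrow> C" using pick_in_set_le by auto
  show "(\<lambda>k. card {a\<in>C. a < k}) \<in> C \<rightarrow> {..<card C}"
    using assms by (auto intro!: psubset_card_mono)
  show "card {a\<in>C. a < pick C i} = i" if "i \<in> {..<card C}" for i
    using that card_pick_le by simp
  show "pick C (card {a\<in>C. a < k}) = k" if "k \<in> C" for k
    using that by (rule pick_card_in_set)
qed

lemma sum_pick:
  assumes "finite C"
  shows "(\<Sum>i<card C. f (pick C i)) = (\<Sum>k\<in>C. f k)"
  using bij_betw_pick[OF assms] by (rule sum.reindex_bij_betw)

lemma qform_pick:
  assumes "finite C"
  shows "qform (\<lambda>i k. s (pick C i) (pick C k)) {..<card C} (\<lambda>i. a (pick C i)) = qform s C a"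
  unfolding qform_def using sum_pick[OF assms] by (simp add: sum_pick[OF assms, where f = "\<lambda>k. a _ * s _ k * a k"])

lemma submatrix_carrier_index:
  assumes "S \<in> carrier_mat p p" "I \<subseteq> {..<p}" "J \<subseteq> {..<p}"
  shows "submatrix S I J \<in> carrier_mat (card I) (card J)"
    and "\<And>i k. i < card I \<Longrightarrow> k < card J \<Longrightarrow> submatrix S I J $$ (i, k) = S $$ (pick I i, pick J k)"
proof -
  have "{i. i < p \<and> i \<in> I} = I" "{i. i < p \<and> i \<in> J} = J" using assms by auto
  then show "submatrix S I J \<in> carrier_mat (card I) (card J)"
    "\<And>i k. i < card I \<Longrightarrow> k < card J \<Longrightarrow> submatrix S I J $$ (i, k) = S $$ (pick I i, pick J k)"
    using assms(1) by (auto simp: submatrix_def)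
qed

text \<open>The eigenvalue hypothesis speaks of principal submatrices of size exactly
  \<open>Suc q\<close>. A smaller support is enlarged to that size and the vector extended by zero,
  which changes neither side.\<close>

lemma restricted_eigenvalue_bound:
  assumes S: "S \<in> carrier_mat p p"
    and sym: "\<And>i k. i < p \<Longrightarrow> k < p \<Longrightarrow> S $$ (i, k) = S $$ (k, i)"
    and lam: "\<And>U. U \<subseteq> {..<p} \<Longrightarrow> card U = Suc q \<Longrightarrow> c \<le> min_eigenvalue (submatrix S U U)"
    and q: "q < p" and T: "T \<subseteq> {..<p}" "card T \<le> Suc q"
  shows "c * (\<Sum>i\<in>T. (a i)\<^sup>2) \<le> qform (\<lambda>i k. S $$ (i, k)) T a"
proof -
  obtain U where U: "T \<subseteq> U" "U \<subseteq> {..<p}" "card U = Suc q"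
    using exists_subset_between[of T "Suc q" "{..<p}"] T q by auto
  have fin: "finite U" using U(2) finite_subset by blast
  let ?s = "\<lambda>i k. S $$ (i, k)" and ?A = "submatrix S U U"
  define b where "b i = (if i \<in> T then a i else 0)" for i
  have A: "?A \<in> carrier_mat (card U) (card U)"
    and Aij: "\<And>i k. i < card U \<Longrightarrow> k < card U \<Longrightarrow> ?A $$ (i, k) = S $$ (pick U i, pick U k)"
    using submatrix_carrier_index[OF S U(2) U(2)] by auto
  have pick: "pick U i < p" if "i < card U" for i
    using pick_in_set_le[OF that] U(2) by auto
  have "c * (\<Sum>i<card U. (b (pick U i))\<^sup>2) \<le> min_eigenvalue ?A * (\<Sum>i<card U. (b (pick U i))\<^sup>2)"
    using lam[OF U(2,3)] by (intro mult_right_mono) (auto intro: sum_nonneg)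
  also have "\<dots> \<le> qform (\<lambda>i k. ?A $$ (i, k)) {..<card U} (\<lambda>i. b (pick U i))"
  proof (rule min_eigenvalue_le_qform[OF A])
    show "0 < card U" using U(3) by simp
    show "?A $$ (i, k) = ?A $$ (k, i)" if "i < card U" "k < card U" for i k
      using that sym[OF pick pick] Aij by simp
  qed
  also have "\<dots> = qform (\<lambda>i k. ?s (pick U i) (pick U k)) {..<card U} (\<lambda>i. b (pick U i))"
    using Aij by (intro qform_cong) auto
  also have "\<dots> = qform ?s U b" by (rule qform_pick[OF fin])
  also have "\<dots> = qform ?s T b"
    using fin U(1) by (intro qform_superset) (auto simp: b_def)
  also have "\<dots> = qform ?s T a" by (intro qform_cong) (auto simp: b_def)
  also have "(\<Sum>i<card U. (b (pick U i))\<^sup>2) = (\<Sum>i\<in>U. (b i)\<^sup>2)" by (rule sum_pick[OF fin])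
  also have "\<dots> = (\<Sum>i\<in>T. (b i)\<^sup>2)"
    using fin U(1) by (intro sum.mono_neutral_right) (auto simp: b_def)
  also have "\<dots> = (\<Sum>i\<in>T. (a i)\<^sup>2)" by (intro sum.cong) (auto simp: b_def)
  finally show ?thesis .
qed

text \<open>A kernel vector of the submatrix would make the form vanish at a nonzero vector. The
  inverse is produced as a value of \<open>mat_inverse\<close> because \<open>cond_var\<close>
  refers to it.\<close>

lemma submatrix_pos_def_inverse:
  assumes S: "S \<in> carrier_mat p p" and C: "C \<subseteq> {..<p}"
    and pd: "\<And>a. \<exists>i\<in>C. a i \<noteq> 0 \<Longrightarrow> 0 < qform (\<lambda>i k. S $$ (i, k)) C a"
  obtains W where "W \<in> carrier_mat (card C) (card C)" "mat_inverse (submatrix S C C) = Some W"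
    "submatrix S C C * W = 1\<^sub>m (card C)" "W * submatrix S C C = 1\<^sub>m (card C)"
proof -
  let ?A = "submatrix S C C" and ?m = "card C"
  have fin: "finite C" using C finite_subset by blast
  have A: "?A \<in> carrier_mat ?m ?m"
    and Aij: "\<And>i k. i < ?m \<Longrightarrow> k < ?m \<Longrightarrow> ?A $$ (i, k) = S $$ (pick C i, pick C k)"
    using submatrix_carrier_index[OF S C C] by auto
  have "det ?A \<noteq> 0"
  proof
    assume "det ?A = 0"
    then obtain v where v: "v \<in> carrier_vec ?m" "v \<noteq> 0\<^sub>v ?m" "?A *\<^sub>v v = 0\<^sub>v ?m"
      using det_0_iff_vec_prod_zero[OF A] by auto
    define a where "a k = v $ card {x\<in>C. x < k}" for k
    have a: "a (pick C i) = v $ i" if "i < ?m" for i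
      using card_pick_le[OF that] by (simp add: a_def)
    obtain i where i: "i < ?m" "v $ i \<noteq> 0" using v(1,2) by (metis eq_vecI carrier_vecD index_zero_vec)
    have "0 < qform (\<lambda>i k. S $$ (i, k)) C a"
      using pd[of a] a[OF i(1)] i(2) pick_in_set_le[OF i(1)] by metis
    also have "\<dots> = qform (\<lambda>i k. S $$ (pick C i, pick C k)) {..<?m} (\<lambda>i. a (pick C i))"
      by (rule qform_pick[OF fin, symmetric])
    also have "\<dots> = qform (\<lambda>i k. ?A $$ (i, k)) {..<?m} (\<lambda>i. v $ i)"
      using Aij a by (intro qform_cong) auto
    also have "\<dots> = (\<Sum>i<?m. v $ i * (?A *\<^sub>v v) $ i)"
      unfolding qform_def using A v(1)
      by (intro sum.cong refl)
        (auto simp: scalar_prod_def sum_distrib_left atLeast0LessThan mult_ac intro!: sum.cong)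
    also have "\<dots> = 0" using v(3) by simp
    finally show False by simp
  qed
  then have unit: "?A \<in> Units (ring_mat TYPE(real) ?m ())"
    by (rule det_non_zero_imp_unit[OF A])
  then obtain W where W: "mat_inverse ?A = Some W"
    using mat_inverse(1)[OF A, of "()"] unit by (cases "mat_inverse ?A") auto
  show ?thesis using mat_inverse(2)[OF A W] W by (intro that) auto
qed

lemma submatrix_pos_def_invertible:
  assumes "S \<in> carrier_mat p p" "C \<subseteq> {..<p}"
    and "\<And>a. \<exists>i\<in>C. a i \<noteq> 0 \<Longrightarrow> 0 < qform (\<lambda>i k. S $$ (i, k)) C a"
  shows "invertible_mat (submatrix S C C)"
  using submatrix_carrier_index(1)[OF assms(1,2,2)] submatrix_pos_def_inverse[OF assms]
  by (metis carrier_matD invertible_mat_def inverts_mat_def square_mat.simps)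

text \<open>Least squares: the vector equal to 1 at \<open>j\<close> and to minus the regression
  coefficients on \<open>C\<close> satisfies the normal equations. Any competitor differs from it by
  a vector supported on \<open>C\<close>, for which the cross term vanishes and the form is
  nonnegative.\<close>

lemma cond_var_minimum:
  assumes S: "S \<in> carrier_mat p p"
    and sym: "\<And>i k. i < p \<Longrightarrow> k < p \<Longrightarrow> S $$ (i, k) = S $$ (k, i)"
    and C: "C \<subseteq> {..<p}" and j: "j < p" "j \<notin> C"
    and pd: "\<And>a. \<exists>i\<in>C. a i \<noteq> 0 \<Longrightarrow> 0 < qform (\<lambda>i k. S $$ (i, k)) C a"
  shows "\<exists>a. a j = 1 \<and> cond_var S C j = qform (\<lambda>i k. S $$ (i, k)) (insert j C) a"
    and "\<And>b. b j = 1 \<Longrightarrow> cond_var S C j \<le> qform (\<lambda>i k. S $$ (i, k)) (insert j C) b"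
proof -
  let ?s = "\<lambda>i k. S $$ (i, k)" and ?A = "submatrix S C C" and ?m = "card C"
  have fin: "finite C" using C finite_subset by blast
  obtain W where W: "W \<in> carrier_mat ?m ?m" "mat_inverse ?A = Some W" "?A * W = 1\<^sub>m ?m"
    using submatrix_pos_def_inverse[OF S C pd] by blast
  have A: "?A \<in> carrier_mat ?m ?m"
    and Aij: "\<And>i k. i < ?m \<Longrightarrow> k < ?m \<Longrightarrow> ?A $$ (i, k) = S $$ (pick C i, pick C k)"
    using submatrix_carrier_index[OF S C C] by auto
  let ?r = "submatrix S {j} C" and ?c = "submatrix S C {j}"
  have pj: "pick {j} 0 = j" using pick_in_set_le[of 0 "{j}"] by simp
  have r: "?r \<in> carrier_mat 1 ?m" "\<And>k. k < ?m \<Longrightarrow> ?r $$ (0, k) = S $$ (j, pick C k)"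
    using submatrix_carrier_index[OF S, of "{j}" C] C j pj by auto
  have c: "?c \<in> carrier_mat ?m 1" "\<And>k. k < ?m \<Longrightarrow> ?c $$ (k, 0) = S $$ (pick C k, j)"
    using submatrix_carrier_index[OF S, of C "{j}"] C j pj by auto
  \<comment> \<open>The regression coefficients of \<open>j\<close> on \<open>C\<close>, moved from
    submatrix positions to vertices.\<close>
  define h where "h k = (W * ?c) $$ (card {x\<in>C. x < k}, 0)" for k
  have h: "h (pick C i) = (W * ?c) $$ (i, 0)" if "i < ?m" for i
    using card_pick_le[OF that] by (simp add: h_def)
  have Wc: "W * ?c \<in> carrier_mat ?m 1" using W c by simp
  have normal_eq: "(\<Sum>l\<in>C. S $$ (k, l) * h l) = S $$ (k, j)" if k: "k \<in> C" for k
  proof -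
    obtain i where i: "i < ?m" "k = pick C i"
      using bij_betw_pick[OF fin] k by (auto simp: bij_betw_def)
    have "(\<Sum>l\<in>C. S $$ (k, l) * h l) = (\<Sum>l<?m. S $$ (k, pick C l) * h (pick C l))"
      by (rule sum_pick[OF fin, symmetric])
    also have "\<dots> = (\<Sum>l<?m. ?A $$ (i, l) * (W * ?c) $$ (l, 0))"
      using i Aij h by (intro sum.cong) auto
    also have "\<dots> = (?A * (W * ?c)) $$ (i, 0)"
      using index_mult_mat_sum[OF A Wc i(1)] by simp
    also have "?A * (W * ?c) = ?c"
      using assoc_mult_mat[OF A W(1) c(1)] W(3) c(1) by simp
    finally show ?thesis using c(2) i by simp
  qed
  have cv: "cond_var S C j = S $$ (j, j) - (\<Sum>l\<in>C. S $$ (j, l) * h l)"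
  proof -
    have "(?r * W * ?c) $$ (0, 0) = (?r * (W * ?c)) $$ (0, 0)"
      using assoc_mult_mat[OF r(1) W(1) c(1)] by simp
    also have "\<dots> = (\<Sum>l<?m. ?r $$ (0, l) * (W * ?c) $$ (l, 0))"
      using index_mult_mat_sum[OF r(1) Wc] by simp
    also have "\<dots> = (\<Sum>l<?m. S $$ (j, pick C l) * h (pick C l))"
      using r(2) h by (intro sum.cong) auto
    also have "\<dots> = (\<Sum>l\<in>C. S $$ (j, l) * h l)" by (rule sum_pick[OF fin])
    finally show ?thesis by (simp add: cond_var_def W(2))
  qed
  define a where "a k = (if k = j then 1 else - h k)" for k
  have aj: "a j = 1" by (simp add: a_def)
  \<comment> \<open>By the normal equations this value is zero for \<open>i\<close> in
    \<open>C\<close> and equals the conditional variance at \<open>j\<close>. It yields both the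
    form at \<open>a\<close> and the vanishing cross term below.\<close>
  have row: "(\<Sum>k\<in>insert j C. S $$ (i, k) * a k) = S $$ (i, j) - (\<Sum>l\<in>C. S $$ (i, l) * h l)" for i
  proof -
    have "(\<Sum>l\<in>C. S $$ (i, l) * a l) = (\<Sum>l\<in>C. - (S $$ (i, l) * h l))"
      using j by (intro sum.cong) (auto simp: a_def)
    then show ?thesis using fin j by (simp add: a_def sum_negf)
  qed
  have "qform ?s (insert j C) a = (\<Sum>i\<in>insert j C. a i * (\<Sum>k\<in>insert j C. S $$ (i, k) * a k))"
    by (simp add: qform_def sum_distrib_left mult_ac)
  also have "\<dots> = (\<Sum>i\<in>insert j C. if i = j then cond_var S C j else 0)"
  proof (intro sum.cong refl)
    fix i assume "i \<in> insert j C"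
    then show "a i * (\<Sum>k\<in>insert j C. S $$ (i, k) * a k) = (if i = j then cond_var S C j else 0)"
      unfolding row using normal_eq aj cv by (cases "i = j") auto
  qed
  also have "\<dots> = cond_var S C j" using fin by simp
  finally have qa: "qform ?s (insert j C) a = cond_var S C j" .
  then show "\<exists>a. a j = 1 \<and> cond_var S C j = qform ?s (insert j C) a"
    by (intro exI[of _ a]) (simp add: a_def)
  show "cond_var S C j \<le> qform ?s (insert j C) b" if b: "b j = 1" for b
  proof -
    define e where "e k = b k - a k" for k
    have ej: "e j = 0" using b by (simp add: e_def a_def)
    have "qform ?s (insert j C) b = qform ?s (insert j C) (\<lambda>k. a k + e k)" by (simp add: e_def)
    also have "\<dots> = qform ?s (insert j C) a
        + 2 * (\<Sum>i\<in>insert j C. e i * (\<Sum>k\<in>insert j C. S $$ (i, k) * a k)) + qform ?s (insert j C) e"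
      using sym C j by (intro qform_add) auto
    also have "(\<Sum>i\<in>insert j C. e i * (\<Sum>k\<in>insert j C. S $$ (i, k) * a k)) = 0"
      unfolding row using normal_eq ej by (intro sum.neutral ballI) auto
    also have "qform ?s (insert j C) e = qform ?s C e"
      using fin ej by (intro qform_superset) auto
    finally have "qform ?s (insert j C) b = cond_var S C j + qform ?s C e" by (simp add: qa)
    moreover have "0 \<le> qform ?s C e"
    proof (cases "\<exists>i\<in>C. e i \<noteq> 0")
      case True then show ?thesis using pd by force
    next
      case False then show ?thesis by (simp add: qform_def)
    qed
    ultimately show ?thesis by simp
  qed
qed


subsection \<open>Total effects in an acyclic graph\<close>

text \<open>The rank of a vertex is the number of its proper ancestors. It grows strictly along an
  edge, since \<open>k\<close> is an ancestor of \<open>j\<close> but, by acyclicity, not of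
  itself.\<close>

lemma acyclic_rank:
  assumes "finite E" "acyclic E"
  obtains r :: "'v \<Rightarrow> nat" where "\<And>k j. (k, j) \<in> E \<Longrightarrow> r k < r j"
proof
  fix k j assume kj: "(k, j) \<in> E"
  have fin: "finite {i. (i, j) \<in> E\<^sup>+}"
    by (rule finite_subset[of _ "Domain E"]) (auto simp: assms(1) finite_Domain dest: tranclD)
  have "{i. (i, k) \<in> E\<^sup>+} \<subset> {i. (i, j) \<in> E\<^sup>+}"
    using kj assms(2) unfolding acyclic_def by (blast intro: trancl_into_trancl)
  with fin show "card {i. (i, k) \<in> E\<^sup>+} < card {i. (i, j) \<in> E\<^sup>+}"
    by (rule psubset_card_mono)
qed

lemma finite_edges: "finite (edges p B)"
  by (rule finite_subset[of _ "{..<p} \<times> {..<p}"]) (auto simp: edges_def)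

text \<open>Closure under parents is the invariant kept by the set of vertices chosen so
  far.\<close>

definition ancestral :: "nat \<Rightarrow> real mat \<Rightarrow> nat set \<Rightarrow> bool" where
  "ancestral p B A \<longleftrightarrow> A \<subseteq> {..<p} \<and> (\<forall>(k, j)\<in>edges p B. j \<in> A \<longrightarrow> k \<in> A)"

text \<open>\<open>P\<close> plays the role of \<open>(I - B)\<^sup>-\<^sup>1\<close>: \<open>P j k\<close> is the coefficient of the noise
  \<open>\<epsilon>\<^sub>k\<close> in \<open>X\<^sub>j\<close>. The rank \<open>r\<close> witnesses acyclicity.\<close>
locale total_effects =
  fixes p :: nat and B :: "real mat" and P :: "nat \<Rightarrow> nat \<Rightarrow> real" and r :: "nat \<Rightarrow> nat"
  assumes edge_rank: "(k, j) \<in> edges p B \<Longrightarrow> r k < r j"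
    and effect_rec: "j < p \<Longrightarrow> P j k = (if j = k then 1 else 0) + (\<Sum>l\<in>{..<p} - {j}. B $$ (j, l) * P l k)"

text \<open>Truncated Neumann series: for \<open>B\<close> with zero diagonal, the
  \<open>(j, k)\<close> entry of I + B + ... + B^(m-1), that is, the total weight of directed walks
  from \<open>k\<close> to \<open>j\<close> with fewer than \<open>m\<close> edges.\<close>

primrec truncated_effect :: "nat \<Rightarrow> real mat \<Rightarrow> nat \<Rightarrow> nat \<Rightarrow> nat \<Rightarrow> real" where
  "truncated_effect p B 0 j k = 0"
| "truncated_effect p B (Suc m) j k =
    (if j = k then 1 else 0) + (\<Sum>l\<in>{..<p} - {j}. B $$ (j, l) * truncated_effect p B m l k)"

text \<open>The truncations at a vertex stop changing once \<open>m\<close> exceeds its rank,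
  because the recursion passes only to parents, which have smaller rank. A level above all ranks
  therefore satisfies the recursion for \<open>P\<close> exactly.\<close>

lemma total_effects_exist:
  assumes "acyclic (edges p B)"
  obtains P r where "total_effects p B P r"
proof -
  obtain r :: "nat \<Rightarrow> nat" where r: "\<And>k j. (k, j) \<in> edges p B \<Longrightarrow> r k < r j"
    using acyclic_rank[OF finite_edges assms] by blast
  have stable: "truncated_effect p B (Suc m) j k = truncated_effect p B m j k"
    if "j < p" "r j < m" for j k m
    using that
  proof (induction m arbitrary: j)
    case (Suc m)
    have "B $$ (j, l) * truncated_effect p B (Suc m) l k = B $$ (j, l) * truncated_effect p B m l k"
      if "l \<in> {..<p} - {j}" for l
    proof (cases "B $$ (j, l) = 0")
      case False
      then have "(l, j) \<in> edges p B" using that Suc.prems by (auto simp: edges_def)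
      then have "r l < m" using r Suc.prems by fastforce
      then show ?thesis using Suc.IH[of l] that by simp
    qed simp
    then show ?case
      unfolding truncated_effect.simps(2)[of p B "Suc m"] truncated_effect.simps(2)[of p B m j]
      by (intro arg_cong2[of _ _ _ _ "(+)"] refl sum.cong) auto
  qed simp
  \<comment> \<open>\<open>insert 0\<close> keeps \<open>Max\<close> defined when
    \<open>p = 0\<close>.\<close>
  define b where "b = Suc (Max (insert 0 (r ` {..<p})))"
  have b: "r j < b" if "j < p" for j
    using that by (auto simp: b_def less_Suc_eq_le intro!: Max_ge)
  have "total_effects p B (truncated_effect p B b) r"
  proof
    show "truncated_effect p B b j k =
        (if j = k then 1 else 0) + (\<Sum>l\<in>{..<p} - {j}. B $$ (j, l) * truncated_effect p B b l k)"
      if "j < p" for j k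
      using stable[OF that b[OF that], of k] by simp
  qed (rule r)
  then show ?thesis by (rule that)
qed

context total_effects
begin

text \<open>Only parents enter the recursion for an effect, and those stay inside \<open>A\<close>.
  By induction on the rank, the noise of an outside vertex never reaches \<open>A\<close>.\<close>

lemma effect_outside:
  assumes "ancestral p B A" "j \<in> A" "k \<notin> A"
  shows "P j k = 0"
  using assms(2)
proof (induction "r j" arbitrary: j rule: less_induct)
  case less
  have jp: "j < p" using less.prems assms(1) by (auto simp: ancestral_def)
  have "B $$ (j, l) * P l k = 0" if "l \<in> {..<p} - {j}" for l
  proof (cases "B $$ (j, l) = 0")
    case False
    then have "(l, j) \<in> edges p B" using that jp by (auto simp: edges_def)
    then have "P l k = 0"
      using less.hyps[of l] edge_rank assms(1) less.prems by (auto simp: ancestral_def)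
    then show ?thesis by simp
  qed simp
  then have "(\<Sum>l\<in>{..<p} - {j}. B $$ (j, l) * P l k) = 0" by (intro sum.neutral) auto
  then show ?case using effect_rec[OF jp, of k] less.prems assms(3) by auto
qed

text \<open>The vertices of rank below \<open>r k\<close> together with \<open>l\<close> form an
  ancestral set that omits \<open>k\<close>.\<close>

lemma effect_rank_eq_0:
  assumes "l < p" "l \<noteq> k" "r l \<le> r k"
  shows "P l k = 0"
proof (rule effect_outside)
  show "ancestral p B {i. i < p \<and> (r i < r k \<or> i = l)}"
    using assms edge_rank unfolding ancestral_def by (fastforce simp: edges_def)
qed (use assms in auto)

lemma parent_rank:
  assumes "j < p" "l < p" "B $$ (j, l) \<noteq> 0"
  shows "r l < r j"
  using assms by (intro edge_rank) (auto simp: edges_def)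

lemma effect_diag:
  assumes "j < p"
  shows "P j j = 1"
proof -
  have "B $$ (j, l) * P l j = 0" if "l \<in> {..<p} - {j}" for l
    using effect_rank_eq_0[of l j] parent_rank[OF assms, of l] that by (cases "B $$ (j, l) = 0") auto
  then have "(\<Sum>l\<in>{..<p} - {j}. B $$ (j, l) * P l j) = 0" by (intro sum.neutral) auto
  then show ?thesis using effect_rec[OF assms, of j] by simp
qed

text \<open>This is \<open>\<sigma>\<^sup>2 (I - B)\<^sup>-\<^sup>1 (I - B)\<^sup>-\<^sup>T\<close>,
  kept free of any probability space; \<open>sem_distribution\<close> identifies it with the second
  moments of \<open>X\<close>.\<close>

definition cov :: "real \<Rightarrow> nat \<Rightarrow> nat \<Rightarrow> real" where
  "cov \<sigma> i k = \<sigma>\<^sup>2 * (\<Sum>l<p. P i l * P k l)"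

text \<open>The variance of a linear combination of the \<open>X\<^sub>i\<close> as a sum of squares
  of its noise coefficients; lower bounds arise by dropping squares.\<close>

lemma qform_cov: "qform (cov \<sigma>) T a = \<sigma>\<^sup>2 * (\<Sum>l<p. (\<Sum>i\<in>T. a i * P i l)\<^sup>2)"
proof -
  have "qform (cov \<sigma>) T a = (\<Sum>i\<in>T. \<Sum>k\<in>T. \<Sum>l<p. \<sigma>\<^sup>2 * ((a i * P i l) * (a k * P k l)))"
    by (simp add: qform_def cov_def sum_distrib_left sum_distrib_right mult_ac)
  also have "\<dots> = (\<Sum>i\<in>T. \<Sum>l<p. \<Sum>k\<in>T. \<sigma>\<^sup>2 * ((a i * P i l) * (a k * P k l)))"
    by (intro sum.cong refl sum.swap)
  also have "\<dots> = (\<Sum>l<p. \<Sum>i\<in>T. \<Sum>k\<in>T. \<sigma>\<^sup>2 * ((a i * P i l) * (a k * P k l)))"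
    by (rule sum.swap)
  also have "\<dots> = \<sigma>\<^sup>2 * (\<Sum>l<p. (\<Sum>i\<in>T. a i * P i l)\<^sup>2)"
    by (simp only: power2_eq_square[of "sum _ _"] sum_product) (simp only: sum_distrib_left)
  finally show ?thesis .
qed

text \<open>The coefficients that recover the noise \<open>\<epsilon>\<^sub>j\<close> from \<open>X\<close>.\<close>
definition noise_coeff :: "nat \<Rightarrow> nat \<Rightarrow> real" where
  "noise_coeff j i = (if i = j then 1 else - B $$ (j, i))"

text \<open>Subtracting the parents' contributions from \<open>X\<^sub>j\<close> leaves
  \<open>\<epsilon>\<^sub>j\<close> alone. \<open>C\<close> may contain further vertices, where the
  coefficient is zero; this matters because candidates have a prescribed size.\<close>

lemma qform_cov_noise_coeff:
  assumes j: "j < p" "j \<notin> C" and C: "C \<subseteq> {..<p}" and pa: "\<And>k. (k, j) \<in> edges p B \<Longrightarrow> k \<in> C"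
  shows "qform (cov \<sigma>) (insert j C) (noise_coeff j) = \<sigma>\<^sup>2"
proof -
  have fin: "finite C" using C finite_subset by blast
  have "(\<Sum>i\<in>insert j C. noise_coeff j i * P i l) = (if l = j then 1 else 0)" for l
  proof -
    have "(\<Sum>i\<in>C. noise_coeff j i * P i l) = (\<Sum>i\<in>C. - (B $$ (j, i) * P i l))"
      using j by (intro sum.cong) (auto simp: noise_coeff_def)
    also have "\<dots> = - (\<Sum>i\<in>C. B $$ (j, i) * P i l)" by (rule sum_negf)
    also have "(\<Sum>i\<in>C. B $$ (j, i) * P i l) = (\<Sum>i\<in>{..<p} - {j}. B $$ (j, i) * P i l)"
      using C j pa by (intro sum.mono_neutral_left) (auto simp: edges_def)
    finally show ?thesis
      using fin j effect_rec[OF j(1), of l] by (simp add: noise_coeff_def)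
  qed
  then show ?thesis
    using j by (simp add: qform_cov if_distrib[of "\<lambda>x. x\<^sup>2"] cong: if_cong)
qed

text \<open>Besides \<open>\<epsilon>\<^sub>j\<close>, the noise of a missing parent of maximal rank cannot be cancelled either.\<close>
lemma qform_cov_missing_parent:
  assumes A: "ancestral p B A" and C: "C \<subseteq> A" and j: "j < p" "j \<notin> A"
    and k: "(k, j) \<in> edges p B" "k \<notin> A"
    and \<zeta>: "\<And>k j. (k, j) \<in> edges p B \<Longrightarrow> \<zeta> \<le> (B $$ (j, k))\<^sup>2"
    and a: "a j = 1"
  shows "\<sigma>\<^sup>2 * (1 + \<zeta>) \<le> qform (cov \<sigma>) (insert j C) a"
proof -
  have Ap: "A \<subseteq> {..<p}" using A by (simp add: ancestral_def)
  then have fin: "finite C" using C finite_subset[of C "{..<p}"] by auto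
  have jC: "j \<notin> C" using C j by auto
  define Q where "Q = {k. (k, j) \<in> edges p B \<and> k \<notin> A}"
  have "finite Q" "Q \<noteq> {}"
    using k finite_subset[of Q "{..<p}"] by (auto simp: Q_def edges_def)
  \<comment> \<open>Maximal rank prevents the noise of \<open>m\<close> from reaching
    \<open>j\<close> through another missing parent.\<close>
  then obtain m where m: "m \<in> Q" "\<And>l. l \<in> Q \<Longrightarrow> r l \<le> r m"
    using Max_in[of "r ` Q"] Max_ge[of "r ` Q"] by (metis (no_types, lifting) finite_imageI image_iff image_is_empty)
  have mp: "m < p" "(m, j) \<in> edges p B" "m \<notin> A" using m(1) by (auto simp: Q_def edges_def)
  have mj: "m \<noteq> j" using edge_rank[OF mp(2)] by auto
  \<comment> \<open>Noises outside \<open>A\<close> do not occur in the variables indexed by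
    \<open>C\<close>, so no choice of \<open>a\<close> cancels them.\<close>
  have coeff: "(\<Sum>i\<in>insert j C. a i * P i l) = P j l" if "l \<notin> A" for l
  proof -
    have "(\<Sum>i\<in>C. a i * P i l) = 0"
      using effect_outside[OF A _ that] C by (intro sum.neutral) auto
    then show ?thesis using fin jC a by simp
  qed
  \<comment> \<open>All indirect contributions vanish: a parent in \<open>A\<close> does not see the
    noise of \<open>m\<close>, and any other missing parent has rank at most \<open>r m\<close>.
    Only the edge from \<open>m\<close> to \<open>j\<close> remains.\<close>
  have "P j m = (\<Sum>l\<in>{..<p} - {j}. B $$ (j, l) * P l m)"
    using effect_rec[OF j(1), of m] mj by simp
  also have "\<dots> = (\<Sum>l\<in>{..<p} - {j}. if l = m then B $$ (j, m) else 0)"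
  proof (intro sum.cong refl)
    fix l assume l: "l \<in> {..<p} - {j}"
    show "B $$ (j, l) * P l m = (if l = m then B $$ (j, m) else 0)"
    proof (cases "B $$ (j, l) = 0 \<or> l = m")
      case True
      then show ?thesis using effect_diag[OF mp(1)] by auto
    next
      case False
      then have e: "(l, j) \<in> edges p B" using l j by (auto simp: edges_def)
      have "P l m = 0"
      proof (cases "l \<in> A")
        case True
        then show ?thesis using effect_outside[OF A _ mp(3)] by blast
      next
        case outside: False
        then show ?thesis using e l False by (intro effect_rank_eq_0 m(2)) (auto simp: Q_def)
      qed
      then show ?thesis using False by simp
    qed
  qed
  also have "\<dots> = B $$ (j, m)" using mp(1) mj by simp
  finally have Pjm: "P j m = B $$ (j, m)" .
  have "1 + \<zeta> \<le> (P j j)\<^sup>2 + (P j m)\<^sup>2"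
    using \<zeta>[OF mp(2)] by (simp add: effect_diag[OF j(1)] Pjm)
  also have "\<dots> = (\<Sum>l\<in>{j, m}. (\<Sum>i\<in>insert j C. a i * P i l)\<^sup>2)"
    using coeff[OF j(2)] coeff[OF mp(3)] mj by simp
  also have "\<dots> \<le> (\<Sum>l<p. (\<Sum>i\<in>insert j C. a i * P i l)\<^sup>2)"
    using j mp(1) by (intro sum_mono2) auto
  finally show ?thesis
    unfolding qform_cov by (rule mult_left_mono) simp
qed

text \<open>A vertex of minimal rank outside \<open>A\<close> works, as each of its parents has
  smaller rank.\<close>

lemma source_exists:
  assumes "A \<subset> {..<p}"
  obtains j where "j < p" "j \<notin> A" "\<And>k. (k, j) \<in> edges p B \<Longrightarrow> k \<in> A"
proof -
  define j where "j = arg_min r (\<lambda>j. j \<in> {..<p} - A)"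
  obtain j0 where "j0 \<in> {..<p} - A" using assms by blast
  then have j: "j \<in> {..<p} - A" "\<And>y. y \<in> {..<p} - A \<Longrightarrow> r j \<le> r y"
    unfolding j_def using arg_min_nat_lemma[of "\<lambda>j. j \<in> {..<p} - A" j0 r] by auto
  show ?thesis
  proof
    show "k \<in> A" if "(k, j) \<in> edges p B" for k
      using j(2)[of k] edge_rank[OF that] that by (auto simp: edges_def)
  qed (use j(1) in auto)
qed

end


subsection \<open>Stability of the algorithm\<close>

text \<open>The eigenvalue bound converts the squared norm in \<open>abs_qform_le\<close> into the
  form itself, so an absolute entrywise error becomes a relative error of the form.\<close>

lemma qform_perturbation:
  assumes lam: "0 < lam" "lam * (\<Sum>i\<in>T. (a i)\<^sup>2) \<le> qform s T a"
    and T: "finite T" "real (card T) \<le> c"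
    and near: "\<And>i k. i \<in> T \<Longrightarrow> k \<in> T \<Longrightarrow> \<bar>s' i k - s i k\<bar> \<le> \<delta>" "0 \<le> \<delta>"
  shows "\<bar>qform s' T a - qform s T a\<bar> \<le> c * \<delta> / lam * qform s T a"
proof -
  have "\<bar>qform s' T a - qform s T a\<bar> \<le> real (card T) * \<delta> * (\<Sum>i\<in>T. (a i)\<^sup>2)"
    unfolding qform_diff[symmetric] using T near by (intro abs_qform_le) auto
  also have "\<dots> \<le> c * \<delta> * (qform s T a / lam)"
    using T near lam by (intro mult_mono) (auto simp: field_simps intro: sum_nonneg)
  finally show ?thesis by simp
qed

context total_effects
begin

definition is_cov :: "real \<Rightarrow> real mat \<Rightarrow> bool" where
  "is_cov \<sigma> S \<longleftrightarrow> S \<in> carrier_mat p p \<and> (\<forall>i<p. \<forall>k<p. S $$ (i, k) = cov \<sigma> i k)"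

lemma is_cov_qform:
  assumes "is_cov \<sigma> S" "T \<subseteq> {..<p}"
  shows "qform (\<lambda>i k. S $$ (i, k)) T a = qform (cov \<sigma>) T a"
  using assms by (intro qform_cong) (auto simp: is_cov_def)

lemma cov_sym: "cov \<sigma> i k = cov \<sigma> k i"
  by (simp add: cov_def mult.commute)

lemma in_deg_parents:
  assumes "in_deg p B j \<le> q"
  shows "finite {k. (k, j) \<in> edges p B}" "card {k. (k, j) \<in> edges p B} \<le> q"
  using assms finite_subset[of "{k. (k, j) \<in> edges p B}" "{..<p}"]
  by (auto simp: in_deg_def edges_def)

text \<open>The test vector consists of the noise coefficients of vertex 0: its squared norm is at
  least 1, its support has at most \<open>q + 1\<close> elements, and the form takes the value
  \<open>\<sigma>\<^sup>2\<close>.\<close>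

lemma restricted_eigenvalue_le_noise_variance:
  assumes cov: "is_cov \<sigma> S" and q: "q < p" and deg: "\<forall>j<p. in_deg p B j \<le> q" and lam0: "0 \<le> lam"
    and lam: "\<And>U. U \<subseteq> {..<p} \<Longrightarrow> card U = Suc q \<Longrightarrow> lam \<le> min_eigenvalue (submatrix S U U)"
  shows "lam \<le> \<sigma>\<^sup>2"
proof -
  have p: "0 < p" using q by simp
  define C where "C = {k. (k, 0) \<in> edges p B}"
  have C: "C \<subseteq> {..<p}" "0 \<notin> C" using edge_rank by (fastforce simp: C_def edges_def)+
  have fin: "finite C" "card C \<le> q" using in_deg_parents deg p by (auto simp: C_def)
  have T: "insert 0 C \<subseteq> {..<p}" "card (insert 0 C) \<le> Suc q"
    using p C fin by (auto simp: card_insert_if)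
  have "lam * 1 \<le> lam * (\<Sum>i\<in>insert 0 C. (noise_coeff 0 i)\<^sup>2)"
    using fin C(2) lam0 by (intro mult_left_mono) (auto simp: noise_coeff_def intro!: sum_nonneg)
  also have "\<dots> \<le> qform (\<lambda>i k. S $$ (i, k)) (insert 0 C) (noise_coeff 0)"
  proof (rule restricted_eigenvalue_bound[OF _ _ lam q T])
    show "S $$ (i, k) = S $$ (k, i)" if "i < p" "k < p" for i k
      using cov that by (simp add: is_cov_def cov_sym[of \<sigma> i k])
  qed (use cov in \<open>simp add: is_cov_def\<close>)
  also have "\<dots> = \<sigma>\<^sup>2"
    unfolding is_cov_qform[OF cov T(1)] using C p by (intro qform_cov_noise_coeff) (auto simp: C_def)
  finally show ?thesis by simp
qed

text \<open>If the minimizer \<open>j\<close> had a parent outside \<open>A\<close>, a vertex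
  \<open>i\<close> with all parents in \<open>A\<close> would have a strictly smaller criterion,
  since \<open>gap\<close> separates the two values even after perturbation.\<close>

lemma step_adds_source:
  assumes cov: "is_cov \<sigma> S" and q: "q < p" and deg: "\<forall>j<p. in_deg p B j \<le> q"
    and lam0: "0 < lam"
    and lam: "\<And>U. U \<subseteq> {..<p} \<Longrightarrow> card U = Suc q \<Longrightarrow> lam \<le> min_eigenvalue (submatrix S U U)"
    and \<zeta>: "0 < \<zeta>" "\<And>k j. (k, j) \<in> edges p B \<Longrightarrow> \<zeta> \<le> (B $$ (j, k))\<^sup>2"
    and S': "S' \<in> carrier_mat p p" "\<And>i k. i < p \<Longrightarrow> k < p \<Longrightarrow> S' $$ (i, k) = S' $$ (k, i)"
    and near: "\<And>i k. i < p \<Longrightarrow> k < p \<Longrightarrow> \<bar>S' $$ (i, k) - S $$ (i, k)\<bar> \<le> \<delta>" "0 \<le> \<delta>"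
    and \<delta>: "(real q + 1) * \<delta> < \<zeta> * lam\<^sup>2 / (\<zeta> * lam + 2 * \<sigma>\<^sup>2)"
    and A: "ancestral p B A"
    and min: "is_arg_min (crit_f2 d q S' A) (\<lambda>j. j \<in> {..<p} - A) j"
  shows "ancestral p B (insert j A)"
proof -
  let ?s = "\<lambda>i k. S $$ (i, k)" and ?s' = "\<lambda>i k. S' $$ (i, k)"
  have Ap: "A \<subseteq> {..<p}" using A by (simp add: ancestral_def)
  then have finA: "finite A" using finite_subset by blast
  have j: "j < p" "j \<notin> A" using min by (auto simp: is_arg_min_def)
  define \<eta> where "\<eta> = (real q + 1) * \<delta> / lam"
  have le: "lam \<le> \<sigma>\<^sup>2"
    by (rule restricted_eigenvalue_le_noise_variance[OF cov q deg less_imp_le[OF lam0] lam])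
  have den: "0 < \<zeta> * lam + 2 * \<sigma>\<^sup>2" using \<zeta>(1) lam0 by (simp add: add_pos_nonneg)
  have "\<eta> < \<zeta> * lam / (\<zeta> * lam + 2 * \<sigma>\<^sup>2)"
    using divide_strict_right_mono[OF \<delta> lam0] lam0 by (simp add: \<eta>_def power2_eq_square)
  then have \<eta>1: "\<eta> * (\<zeta> * lam + 2 * \<sigma>\<^sup>2) < \<zeta> * lam" using den by (simp add: field_simps)
  have \<eta>0: "0 \<le> \<eta>" using near(2) lam0 by (simp add: \<eta>_def)
  \<comment> \<open>\<open>lam \<le> \<sigma>\<^sup>2\<close> lets the noise variance be replaced by
    \<open>lam\<close> in the bound on \<open>\<eta>\<close>, which reduces the claim to
    \<open>\<eta> * (2 + \<zeta>) < \<zeta>\<close>.\<close>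
  have gap: "(1 + \<eta>) * \<sigma>\<^sup>2 < (1 - \<eta>) * (\<sigma>\<^sup>2 * (1 + \<zeta>))"
  proof -
    have "lam * (\<eta> * (2 + \<zeta>)) \<le> \<eta> * (\<zeta> * lam + 2 * \<sigma>\<^sup>2)"
      using mult_left_mono[OF le \<eta>0] by (simp add: algebra_simps)
    also have "\<dots> < lam * \<zeta>" using \<eta>1 by (simp add: mult.commute)
    finally have "\<eta> * (2 + \<zeta>) < \<zeta>" using lam0 by simp
    then have "1 + \<eta> < (1 - \<eta>) * (1 + \<zeta>)" by (simp add: algebra_simps)
    then have "\<sigma>\<^sup>2 * (1 + \<eta>) < \<sigma>\<^sup>2 * ((1 - \<eta>) * (1 + \<zeta>))"
      using le lam0 by (intro mult_strict_left_mono) auto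
    then show ?thesis by (simp add: algebra_simps)
  qed
  have \<eta>lt1: "\<eta> < 1"
  proof -
    have "0 < (1 - \<eta>) * (\<sigma>\<^sup>2 * (1 + \<zeta>))" using gap \<eta>0 by (smt (verit) mult_nonneg_nonneg zero_le_power2)
    moreover have "0 < \<sigma>\<^sup>2 * (1 + \<zeta>)" using le lam0 \<zeta>(1) by (intro mult_pos_pos) linarith+
    ultimately show ?thesis using zero_less_mult_pos2 by fastforce
  qed
  have Sc: "S \<in> carrier_mat p p" using cov by (simp add: is_cov_def)
  have symS: "S $$ (i, k) = S $$ (k, i)" if "i < p" "k < p" for i k
    using cov that by (simp add: is_cov_def cov_sym[of \<sigma> i k])
  have bound: "lam * (\<Sum>i\<in>T. (a i)\<^sup>2) \<le> qform ?s T a"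
    "\<bar>qform ?s' T a - qform ?s T a\<bar> \<le> \<eta> * qform ?s T a"
    if T: "T \<subseteq> {..<p}" "card T \<le> Suc q" for T a
  proof -
    show 1: "lam * (\<Sum>i\<in>T. (a i)\<^sup>2) \<le> qform ?s T a"
      by (rule restricted_eigenvalue_bound[OF Sc symS lam q T])
    show "\<bar>qform ?s' T a - qform ?s T a\<bar> \<le> \<eta> * qform ?s T a"
      unfolding \<eta>_def
    proof (rule qform_perturbation[OF lam0 1])
      show "finite T" using T(1) finite_subset by blast
      show "real (card T) \<le> real q + 1" using T(2) by simp
    qed (use T near in auto)
  qed
  \<comment> \<open>Definiteness passes to \<open>S'\<close> because \<open>\<eta> < 1\<close>;
    hence every matrix to be inverted is regular and the default \<open>d\<close> is never
    reached.\<close>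
  have pd: "0 < qform ?s' C a" if C: "C \<subseteq> {..<p}" "card C \<le> q" and a: "\<exists>i\<in>C. a i \<noteq> 0" for C a
  proof -
    have "finite C" using C(1) finite_subset by blast
    then have "0 < (\<Sum>i\<in>C. (a i)\<^sup>2)" using a by (auto intro: sum_pos2)
    then have "0 < lam * (\<Sum>i\<in>C. (a i)\<^sup>2)" using lam0 by simp
    also have "\<dots> \<le> qform ?s C a" using C by (intro bound(1)) auto
    finally have "0 < (1 - \<eta>) * qform ?s C a" using \<eta>lt1 by simp
    also have "\<dots> \<le> qform ?s' C a" using bound(2)[of C a] C by (simp add: algebra_simps abs_le_iff)
    finally show ?thesis .
  qed
  define K where "K = candidates q A"
  have K: "C \<subseteq> A" "C \<subseteq> {..<p}" "card C \<le> q" "finite C" if "C \<in> K" for C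
    using that Ap finA finite_subset by (auto simp: K_def candidates_def)
  have finK: "finite K" unfolding K_def candidates_def
    by (rule finite_subset[of _ "Pow A"]) (auto simp: finA)
  have crit: "crit_f2 d q S' A i = Min ((\<lambda>C. cond_var S' C i) ` K)" for i
  proof -
    have "invertible_mat (submatrix S' C C)" if "C \<in> K" for C
      using K[OF that] pd S'(1) by (intro submatrix_pos_def_invertible) auto
    then show ?thesis by (simp add: crit_f2_def K_def)
  qed
  have ins: "insert i C \<subseteq> {..<p}" "card (insert i C) \<le> Suc q" "i \<notin> C"
    if "C \<in> K" "i < p" "i \<notin> A" for i C
    using K[OF that(1)] that by (auto simp: card_insert_if)
  obtain C0 where "C0 \<subseteq> A" "card C0 = min q (card A)"
    using obtain_subset_with_card_n[OF min.cobounded2] by metis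
  then have neK: "K \<noteq> {}" by (auto simp: K_def candidates_def)
  have "k \<in> A" if k: "(k, j) \<in> edges p B" for k
  proof (rule ccontr)
    assume kA: "k \<notin> A"
    have "A \<subset> {..<p}" using Ap j by auto
    then obtain i where i: "i < p" "i \<notin> A" "\<And>k. (k, i) \<in> edges p B \<Longrightarrow> k \<in> A"
      using source_exists by blast
    have "{k. (k, i) \<in> edges p B} \<subseteq> A" using i(3) by blast
    \<comment> \<open>The number of parents is bounded both by the in-degree and by
      \<open>card A\<close>, so the parent set can be enlarged inside \<open>A\<close> to a
      candidate of the exact size.\<close>
    moreover have "card {k. (k, i) \<in> edges p B} \<le> min q (card A)"
      using in_deg_parents[of i q] deg i(1) calculation card_mono[OF finA] by auto
    ultimately obtain C where C: "{k. (k, i) \<in> edges p B} \<subseteq> C" "C \<subseteq> A" "card C = min q (card A)"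
      using exists_subset_between[of "{k. (k, i) \<in> edges p B}" "min q (card A)" A] finA by auto
    have CK: "C \<in> K" using C by (simp add: K_def candidates_def)
    \<comment> \<open>Upper bound at \<open>i\<close>: one candidate and one test vector suffice,
      since criterion and \<open>cond_var\<close> are both minima.\<close>
    have "crit_f2 d q S' A i \<le> cond_var S' C i"
      unfolding crit using finK CK by (intro Min_le) auto
    also have "\<dots> \<le> qform ?s' (insert i C) (noise_coeff i)"
      using cond_var_minimum(2)[OF S', of C i "noise_coeff i"] pd K[OF CK] ins[OF CK i(1,2)] i(1)
      by (auto simp: noise_coeff_def)
    also have "\<dots> \<le> (1 + \<eta>) * qform ?s (insert i C) (noise_coeff i)"
      using bound(2)[OF ins(1,2)[OF CK i(1,2)], of "noise_coeff i"] by (simp add: algebra_simps abs_le_iff)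
    also have "qform ?s (insert i C) (noise_coeff i) = \<sigma>\<^sup>2"
      unfolding is_cov_qform[OF cov ins(1)[OF CK i(1,2)]]
      using i K[OF CK] C ins[OF CK i(1,2)] by (intro qform_cov_noise_coeff) auto
    finally have upper: "crit_f2 d q S' A i \<le> (1 + \<eta>) * \<sigma>\<^sup>2" .
    \<comment> \<open>Lower bound at \<open>j\<close>: whichever candidate and vector attain the
      minimum, \<open>qform_cov_missing_parent\<close> applies to them.\<close>
    have "crit_f2 d q S' A j \<in> (\<lambda>C. cond_var S' C j) ` K"
      unfolding crit using finK neK by (intro Min_in) auto
    then obtain C' where C': "C' \<in> K" "crit_f2 d q S' A j = cond_var S' C' j" by auto
    obtain a where a: "a j = 1" "cond_var S' C' j = qform ?s' (insert j C') a"
      using cond_var_minimum(1)[OF S', of C' j] pd K[OF C'(1)] ins[OF C'(1) j] j(1) by auto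
    have "(1 - \<eta>) * (\<sigma>\<^sup>2 * (1 + \<zeta>)) \<le> (1 - \<eta>) * qform ?s (insert j C') a"
      unfolding is_cov_qform[OF cov ins(1)[OF C'(1) j]]
      by (intro mult_left_mono qform_cov_missing_parent[OF A K(1)[OF C'(1)] j k kA \<zeta>(2)])
        (use \<eta>lt1 a(1) in auto)
    also have "\<dots> \<le> crit_f2 d q S' A j"
      using bound(2)[OF ins(1,2)[OF C'(1) j], of a] C'(2) a(2) by (simp add: algebra_simps abs_le_iff)
    also have "\<dots> \<le> crit_f2 d q S' A i"
      using min i(1,2) unfolding is_arg_min_def by (metis Diff_iff lessThan_iff not_less)
    also note upper
    finally show False using gap by simp
  qed
  then show ?thesis using A j(1) by (auto simp: ancestral_def)
qed

end

section \<open>From single steps to the output list\<close>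

text \<open>Every prefix is ancestral, by induction on its length. The prefix ending with
  \<open>j\<close> thus contains each parent of \<open>j\<close>, and without loops the parent
  stands strictly earlier.\<close>

lemma output_topological_ordering:
  assumes out: "topological_ordering_output p f S \<theta>"
    and step: "\<And>A j. ancestral p B A \<Longrightarrow> is_arg_min (f S A) (\<lambda>j. j \<in> {..<p} - A) j \<Longrightarrow> ancestral p B (insert j A)"
    and loop_free: "\<And>j. (j, j) \<notin> edges p B"
  shows "topological_ordering p B \<theta>"
proof -
  have len: "length \<theta> = p"
    and arg: "\<And>z. z < p \<Longrightarrow> is_arg_min (f S (set (take z \<theta>))) (\<lambda>j. j \<in> {..<p} - set (take z \<theta>)) (\<theta> ! z)"
    using out by (auto simp: topological_ordering_output_def)
  have prefix: "ancestral p B (set (take z \<theta>)) \<and> distinct (take z \<theta>)" if "z \<le> p" for z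
    using that
  proof (induction z)
    case 0
    then show ?case by (simp add: ancestral_def)
  next
    case (Suc z)
    then have "take (Suc z) \<theta> = take z \<theta> @ [\<theta> ! z]" using len by (simp add: take_Suc_conv_app_nth)
    then show ?case
      using Suc step[OF _ arg[of z]] arg[of z] by (auto simp: is_arg_min_def)
  qed
  have anc: "ancestral p B (set \<theta>)" and dist: "distinct \<theta>" using prefix[of p] len by auto
  have "set \<theta> = {..<p}"
    using anc dist len by (intro card_subset_eq) (auto simp: ancestral_def distinct_card)
  moreover have "\<exists>a b. a < b \<and> b < length \<theta> \<and> \<theta> ! a = k \<and> \<theta> ! b = j" if e: "(k, j) \<in> edges p B" for k j
  proof -
    have "j \<in> set \<theta>" using e calculation by (auto simp: edges_def)
    then obtain b where b: "b < length \<theta>" "\<theta> ! b = j" by (auto simp: in_set_conv_nth)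
    have "j \<in> set (take (Suc b) \<theta>)" using b by (auto simp: take_Suc_conv_app_nth)
    then have "k \<in> set (take (Suc b) \<theta>)"
      using prefix[of "Suc b"] b(1) len e by (auto simp: ancestral_def)
    moreover have "k \<noteq> j" using e loop_free by auto
    ultimately have "k \<in> set (take b \<theta>)" using b by (auto simp: take_Suc_conv_app_nth)
    then obtain a where "a < b" "\<theta> ! a = k" using b(1) by (auto simp: in_set_conv_nth)
    then show ?thesis using b by blast
  qed
  ultimately show ?thesis using dist by (auto simp: topological_ordering_def)
qed

lemma min_edge_strength_bounds:
  assumes "is_min_edge_strength p B \<zeta>"
  shows "0 < \<zeta>" "\<And>k j. (k, j) \<in> edges p B \<Longrightarrow> \<zeta> \<le> (B $$ (j, k))\<^sup>2"
proof -
  let ?F = "(\<lambda>(k, j). (B $$ (j, k))\<^sup>2) ` edges p B"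
  have fin: "finite ?F" using finite_edges by simp
  show "0 < \<zeta>"
  proof (cases "edges p B = {}")
    case False
    then have "\<zeta> \<in> ?F"
      using assms Min_in[OF fin] by (auto simp: is_min_edge_strength_def)
    then show ?thesis by (auto simp: edges_def)
  qed (use assms in \<open>auto simp: is_min_edge_strength_def\<close>)
  show "\<zeta> \<le> (B $$ (j, k))\<^sup>2" if e: "(k, j) \<in> edges p B" for k j
  proof -
    have "(B $$ (j, k))\<^sup>2 \<in> ?F" using e by force
    moreover have "\<zeta> = Min ?F" using e assms by (auto simp: is_min_edge_strength_def split: if_splits)
    ultimately show ?thesis using Min_le[OF fin] by simp
  qed
qed

lemma (in total_effects) algorithm_correct:
  assumes cov: "is_cov \<sigma> S" and q: "q < p" and deg: "\<forall>j<p. in_deg p B j \<le> q"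
    and lam: "0 < lam" "\<And>U. U \<subseteq> {..<p} \<Longrightarrow> card U = Suc q \<Longrightarrow> lam \<le> min_eigenvalue (submatrix S U U)"
    and \<zeta>: "0 < \<zeta>" "\<And>k j. (k, j) \<in> edges p B \<Longrightarrow> \<zeta> \<le> (B $$ (j, k))\<^sup>2"
    and S': "S' \<in> carrier_mat p p" "\<And>i k. i < p \<Longrightarrow> k < p \<Longrightarrow> S' $$ (i, k) = S' $$ (k, i)"
    and near: "\<And>i k. i < p \<Longrightarrow> k < p \<Longrightarrow>
      \<bar>S' $$ (i, k) - S $$ (i, k)\<bar> < \<zeta> * lam\<^sup>2 / ((real q + 1) * (\<zeta> * lam + 2 * \<sigma>\<^sup>2))"
    and out: "topological_ordering_output p (crit_f2 d q) S' \<theta>"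
  shows "topological_ordering p B \<theta>"
proof -
  \<comment> \<open>The largest of finitely many deviations: one \<open>\<delta>\<close> bounds all
    entries and still satisfies the strict inequality.\<close>
  define \<delta> where "\<delta> = Max ((\<lambda>(i, k). \<bar>S' $$ (i, k) - S $$ (i, k)\<bar>) ` ({..<p} \<times> {..<p}))"
  let ?E = "(\<lambda>(i, k). \<bar>S' $$ (i, k) - S $$ (i, k)\<bar>) ` ({..<p} \<times> {..<p})"
  have fin: "finite ?E" by simp
  have "?E \<noteq> {}" using q by auto
  then have "\<delta> \<in> ?E" unfolding \<delta>_def using Max_in[OF fin] by blast
  then have \<delta>: "0 \<le> \<delta>" "\<delta> < \<zeta> * lam\<^sup>2 / ((real q + 1) * (\<zeta> * lam + 2 * \<sigma>\<^sup>2))"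
    using near by auto
  have near': "\<bar>S' $$ (i, k) - S $$ (i, k)\<bar> \<le> \<delta>" if "i < p" "k < p" for i k
    unfolding \<delta>_def using that by (intro Max_ge[OF fin]) force
  have "(real q + 1) * \<delta> < (real q + 1) * (\<zeta> * lam\<^sup>2 / ((real q + 1) * (\<zeta> * lam + 2 * \<sigma>\<^sup>2)))"
    using \<delta>(2) by (intro mult_strict_left_mono) auto
  also have "\<dots> = \<zeta> * lam\<^sup>2 / (\<zeta> * lam + 2 * \<sigma>\<^sup>2)" by simp
  finally have \<delta>': "(real q + 1) * \<delta> < \<zeta> * lam\<^sup>2 / (\<zeta> * lam + 2 * \<sigma>\<^sup>2)" .
  show ?thesis
  proof (rule output_topological_ordering[OF out])
    show "ancestral p B (insert j A)"
      if "ancestral p B A" "is_arg_min (crit_f2 d q S' A) (\<lambda>j. j \<in> {..<p} - A) j" for A j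
      by (rule step_adds_source[OF cov q deg lam \<zeta> S' near' \<delta>(1) \<delta>' that])
    show "(j, j) \<notin> edges p B" for j using edge_rank[of j j] by auto
  qed
qed


subsection \<open>Sub-Gaussian variables and concentration\<close>

lemma power_over_fact_le_exp:
  fixes x :: real
  assumes "0 \<le> x"
  shows "x ^ n / fact n \<le> exp x"
proof -
  have "(\<Sum>i\<in>{n}. x ^ i /\<^sub>R fact i) \<le> (\<Sum>i. x ^ i /\<^sub>R fact i)"
    using assms summable_exp_generic[of x] by (intro sum_le_suminf) auto
  then show ?thesis by (simp add: exp_def divide_inverse mult.commute)
qed

text \<open>For \<open>m = r\<close> it replaces \<open>fact (2 * r)\<close> by
  \<open>fact r * real (2 * r) ^ r\<close>, which leaves a single \<open>fact r\<close> in the even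
  moment bound.\<close>

lemma fact_add_le: "fact (r + m) \<le> (fact r :: real) * real (r + m) ^ m"
proof (induction m)
  case (Suc m)
  have "fact (r + Suc m) = real (r + Suc m) * fact (r + m)" by simp
  also have "\<dots> \<le> real (r + Suc m) * (fact r * real (r + m) ^ m)"
    using Suc by (intro mult_left_mono) auto
  also have "\<dots> \<le> real (r + Suc m) * (fact r * real (r + Suc m) ^ m)"
    by (intro mult_left_mono power_mono) auto
  finally show ?case by (simp add: mult_ac)
qed simp

context prob_space
begin

lemma sub_gaussian_mono:
  assumes "sub_gaussian g U" "0 \<le> g" "g \<le> g'"
  shows "sub_gaussian g' U"
  unfolding sub_gaussian_def
proof (intro allI conjI)
  fix t
  have "expectation (\<lambda>\<omega>. exp (t * U \<omega>)) \<le> exp (g\<^sup>2 * t\<^sup>2 / 2)"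
    using assms by (simp add: sub_gaussian_def)
  also have "\<dots> \<le> exp (g'\<^sup>2 * t\<^sup>2 / 2)"
    using assms by (simp add: mult_right_mono power_mono)
  finally show "expectation (\<lambda>\<omega>. exp (t * U \<omega>)) \<le> exp (g'\<^sup>2 * t\<^sup>2 / 2)" .
qed (use assms in \<open>simp add: sub_gaussian_def\<close>)

text \<open>The bound \<open>x\<^sup>2\<^sup>r / (2r)! \<le> e\<^sup>x + e\<^sup>-\<^sup>x\<close> is used at the scale \<open>t = \<surd>(2r) / g\<close> that
  minimizes the resulting estimate.\<close>
lemma sub_gaussian_even_moment:
  assumes sg: "sub_gaussian g U" and g: "0 < g" and [measurable]: "random_variable borel U"
  shows "integrable M (\<lambda>\<omega>. U \<omega> ^ (2 * r))"
    and "expectation (\<lambda>\<omega>. U \<omega> ^ (2 * r)) \<le> fact r * (6 * g\<^sup>2) ^ r"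
proof -
  have "integrable M (\<lambda>\<omega>. U \<omega> ^ (2 * r)) \<and> expectation (\<lambda>\<omega>. U \<omega> ^ (2 * r)) \<le> fact r * (6 * g\<^sup>2) ^ r"
  proof (cases "r = 0")
    case True
    then show ?thesis by (simp add: prob_space)
  next
    case False
    define t where "t = sqrt (real (2 * r)) / g"
    have t0: "0 < t" using g False by (simp add: t_def)
    have t2: "t\<^sup>2 = real (2 * r) / g\<^sup>2" by (simp add: t_def power_divide)
    define c where "c = fact (2 * r) / t ^ (2 * r)"
    have c0: "0 < c" using t0 by (simp add: c_def)
    have pw: "U \<omega> ^ (2 * r) \<le> c * (exp (t * U \<omega>) + exp (- t * U \<omega>))" for \<omega>
    proof -
      have "\<bar>t * U \<omega>\<bar> ^ (2 * r) / fact (2 * r) \<le> exp \<bar>t * U \<omega>\<bar>"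
        by (rule power_over_fact_le_exp) simp
      also have "\<dots> \<le> exp (t * U \<omega>) + exp (- t * U \<omega>)"
        by (cases "0 \<le> t * U \<omega>") (auto simp: abs_if)
      finally have "t ^ (2 * r) * U \<omega> ^ (2 * r) / fact (2 * r) \<le> exp (t * U \<omega>) + exp (- t * U \<omega>)"
        by (simp add: power_even_abs power_mult_distrib del: fact_Suc)
      then have "c * (t ^ (2 * r) * U \<omega> ^ (2 * r) / fact (2 * r)) \<le> c * (exp (t * U \<omega>) + exp (- t * U \<omega>))"
        using c0 by (intro mult_left_mono) auto
      then show ?thesis using t0 by (simp add: c_def)
    qed
    have exps: "integrable M (\<lambda>\<omega>. exp (t * U \<omega>))" "integrable M (\<lambda>\<omega>. exp (- t * U \<omega>))"
      "expectation (\<lambda>\<omega>. exp (t * U \<omega>)) \<le> exp (g\<^sup>2 * t\<^sup>2 / 2)"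
      "expectation (\<lambda>\<omega>. exp (- t * U \<omega>)) \<le> exp (g\<^sup>2 * t\<^sup>2 / 2)"
      using sg[unfolded sub_gaussian_def, rule_format, of t] sg[unfolded sub_gaussian_def, rule_format, of "- t"] by auto
    have int: "integrable M (\<lambda>\<omega>. c * (exp (t * U \<omega>) + exp (- t * U \<omega>)))"
      using exps by (intro integrable_mult_right Bochner_Integration.integrable_add)
    have nonneg: "0 \<le> U \<omega> ^ (2 * r)" for \<omega> by (simp add: power_mult)
    have int': "integrable M (\<lambda>\<omega>. U \<omega> ^ (2 * r))"
    proof (rule Bochner_Integration.integrable_bound[OF int])
      show "AE \<omega> in M. norm (U \<omega> ^ (2 * r)) \<le> norm (c * (exp (t * U \<omega>) + exp (- t * U \<omega>)))"
      proof (rule AE_I2)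
        fix \<omega>
        have "norm (U \<omega> ^ (2 * r)) = U \<omega> ^ (2 * r)" using nonneg by (simp add: abs_of_nonneg)
        also have "\<dots> \<le> norm (c * (exp (t * U \<omega>) + exp (- t * U \<omega>)))" using pw[of \<omega>] by simp
        finally show "norm (U \<omega> ^ (2 * r)) \<le> norm (c * (exp (t * U \<omega>) + exp (- t * U \<omega>)))" .
      qed
    qed measurable
    have "expectation (\<lambda>\<omega>. U \<omega> ^ (2 * r)) \<le> expectation (\<lambda>\<omega>. c * (exp (t * U \<omega>) + exp (- t * U \<omega>)))"
      using pw by (intro integral_mono int int')
    also have "\<dots> = c * (expectation (\<lambda>\<omega>. exp (t * U \<omega>)) + expectation (\<lambda>\<omega>. exp (- t * U \<omega>)))"
      using exps(1,2) by simp
    also have "\<dots> \<le> c * (exp (g\<^sup>2 * t\<^sup>2 / 2) + exp (g\<^sup>2 * t\<^sup>2 / 2))"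
      using exps(3,4) c0 by (intro mult_left_mono add_mono) auto
    also have "g\<^sup>2 * t\<^sup>2 / 2 = real r" using g by (simp add: t2)
    also have "exp (real r) + exp (real r) = 2 * exp 1 ^ r" by (simp add: exp_of_nat_mult[symmetric])
    \<comment> \<open>Rounding \<open>exp 1\<close> up to 3 and 2 up to \<open>2 ^ r\<close>
      produces the base 6 of the moment bound.\<close>
    also have "c * (2 * exp 1 ^ r) \<le> c * (2 ^ r * 3 ^ r)"
    proof (intro mult_left_mono mult_mono power_mono)
      show "2 \<le> (2::real) ^ r" using False by (cases r) auto
    qed (use exp_le c0 in auto)
    also have "\<dots> \<le> fact r * real (2 * r) ^ r / t ^ (2 * r) * (2 ^ r * 3 ^ r)"
      using fact_add_le[of r r] t0
      by (intro mult_right_mono) (auto simp: c_def mult_2[symmetric] divide_right_mono)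
    also have "\<dots> = fact r * (6 * g\<^sup>2) ^ r"
    proof -
      have "real (2 * r) ^ r / t ^ (2 * r) = (g\<^sup>2) ^ r"
        using False g by (simp add: power_mult t2 power_divide)
      moreover have "(2::real) ^ r * 3 ^ r = 6 ^ r" by (simp add: power_mult_distrib[symmetric])
      ultimately show ?thesis by (simp add: power_mult_distrib mult_ac flip: times_divide_eq_right)
    qed
    finally show ?thesis using int' by blast
  qed
  then show "integrable M (\<lambda>\<omega>. U \<omega> ^ (2 * r))"
    and "expectation (\<lambda>\<omega>. U \<omega> ^ (2 * r)) \<le> fact r * (6 * g\<^sup>2) ^ r" by auto
qed

text \<open>The arithmetic-geometric mean inequality reduces the product to two even moments,
  whatever the dependence between \<open>U\<close> and \<open>V\<close>.\<close>

lemma sub_gaussian_product_moment: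
  assumes U: "sub_gaussian g U" "random_variable borel U"
    and V: "sub_gaussian g V" "random_variable borel V" and g: "0 < g"
  shows "integrable M (\<lambda>\<omega>. \<bar>U \<omega> * V \<omega>\<bar> ^ r)"
    and "expectation (\<lambda>\<omega>. \<bar>U \<omega> * V \<omega>\<bar> ^ r) \<le> fact r * (6 * g\<^sup>2) ^ r"
proof -
  note [measurable] = U(2) V(2)
  note mU = sub_gaussian_even_moment[OF U(1) g U(2), of r]
  note mV = sub_gaussian_even_moment[OF V(1) g V(2), of r]
  have pw: "\<bar>U \<omega> * V \<omega>\<bar> ^ r \<le> (U \<omega> ^ (2 * r) + V \<omega> ^ (2 * r)) / 2" for \<omega>
  proof -
    have "0 \<le> (\<bar>U \<omega>\<bar> ^ r - \<bar>V \<omega>\<bar> ^ r)\<^sup>2" by simp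
    also have "\<dots> = U \<omega> ^ (2 * r) + V \<omega> ^ (2 * r) - 2 * \<bar>U \<omega> * V \<omega>\<bar> ^ r"
      by (simp add: power2_diff abs_mult power_mult_distrib power_mult[symmetric] mult.commute[of r 2] power_even_abs)
    finally show ?thesis by simp
  qed
  have int: "integrable M (\<lambda>\<omega>. (U \<omega> ^ (2 * r) + V \<omega> ^ (2 * r)) / 2)"
    using mU(1) mV(1) by simp
  show int': "integrable M (\<lambda>\<omega>. \<bar>U \<omega> * V \<omega>\<bar> ^ r)"
  proof (rule Bochner_Integration.integrable_bound[OF int])
    show "AE \<omega> in M. norm (\<bar>U \<omega> * V \<omega>\<bar> ^ r) \<le> norm ((U \<omega> ^ (2 * r) + V \<omega> ^ (2 * r)) / 2)"
    proof (rule AE_I2)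
      fix \<omega>
      have "norm (\<bar>U \<omega> * V \<omega>\<bar> ^ r) = \<bar>U \<omega> * V \<omega>\<bar> ^ r" by simp
      also have "\<dots> \<le> norm ((U \<omega> ^ (2 * r) + V \<omega> ^ (2 * r)) / 2)" using pw[of \<omega>] by simp
      finally show "norm (\<bar>U \<omega> * V \<omega>\<bar> ^ r) \<le> norm ((U \<omega> ^ (2 * r) + V \<omega> ^ (2 * r)) / 2)" .
    qed
  qed measurable
  have "expectation (\<lambda>\<omega>. \<bar>U \<omega> * V \<omega>\<bar> ^ r) \<le> expectation (\<lambda>\<omega>. (U \<omega> ^ (2 * r) + V \<omega> ^ (2 * r)) / 2)"
    using pw by (intro integral_mono int int')
  also have "\<dots> = (expectation (\<lambda>\<omega>. U \<omega> ^ (2 * r)) + expectation (\<lambda>\<omega>. V \<omega> ^ (2 * r))) / 2"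
    using mU(1) mV(1) by simp
  also have "\<dots> \<le> fact r * (6 * g\<^sup>2) ^ r" using mU(2) mV(2) by simp
  finally show "expectation (\<lambda>\<omega>. \<bar>U \<omega> * V \<omega>\<bar> ^ r) \<le> fact r * (6 * g\<^sup>2) ^ r" .
qed

text \<open>Factorial growth of the moments bounds the expected terms of the exponential series from
  order two on by a geometric series with ratio at most 1/2. The first-order term is kept exact, so
  the mean appears in the exponent.\<close>

lemma mgf_bound_of_moments:
  fixes Z :: "'a \<Rightarrow> real" and b t :: real
  assumes mom: "\<And>r. integrable M (\<lambda>\<omega>. \<bar>Z \<omega>\<bar> ^ r)" "\<And>r. expectation (\<lambda>\<omega>. \<bar>Z \<omega>\<bar> ^ r) \<le> fact r * b ^ r"
    and [measurable]: "random_variable borel Z" and b: "0 \<le> b" "\<bar>t\<bar> * b \<le> 1 / 2"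
  shows "integrable M (\<lambda>\<omega>. exp (t * Z \<omega>))"
    and "expectation (\<lambda>\<omega>. exp (t * Z \<omega>)) \<le> exp (t * expectation Z + 2 * (t * b)\<^sup>2)"
proof -
  \<comment> \<open>Shifted by 2: the series of \<open>f\<close> is the second-order remainder of
    the exponential series at \<open>\<bar>t * Z \<omega>\<bar>\<close>.\<close>
  define f where "f r \<omega> = \<bar>t * Z \<omega>\<bar> ^ (r + 2) / fact (r + 2)" for r \<omega>
  define x where "x = \<bar>t\<bar> * b"
  have x: "0 \<le> x" "x \<le> 1 / 2" using b by (auto simp: x_def)
  have fint: "integrable M (f r)" for r
    unfolding f_def abs_mult power_mult_distrib using mom(1)[of "r + 2"] by simp
  have f0: "0 \<le> f r \<omega>" for r \<omega> by (simp add: f_def)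
  have fE: "expectation (f r) \<le> x ^ 2 * x ^ r" for r
  proof -
    have "expectation (f r) = \<bar>t\<bar> ^ (r + 2) * expectation (\<lambda>\<omega>. \<bar>Z \<omega>\<bar> ^ (r + 2)) / fact (r + 2)"
      unfolding f_def abs_mult power_mult_distrib by simp
    also have "\<dots> \<le> \<bar>t\<bar> ^ (r + 2) * (fact (r + 2) * b ^ (r + 2)) / fact (r + 2)"
      using mom(2)[of "r + 2"] by (intro divide_right_mono mult_left_mono) auto
    also have "\<dots> = x ^ (r + 2)" by (simp add: x_def power_mult_distrib del: fact_Suc power_Suc add_2_eq_Suc')
    finally show ?thesis by (simp only: power_add mult.commute)
  qed
  have sums: "(\<lambda>r. \<bar>t * Z \<omega>\<bar> ^ r / fact r) sums exp \<bar>t * Z \<omega>\<bar>" for \<omega>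
    using exp_converges[of "\<bar>t * Z \<omega>\<bar>"] by (simp add: divide_inverse mult.commute)
  have fsum: "(\<lambda>r. f r \<omega>) sums (exp \<bar>t * Z \<omega>\<bar> - (1 + \<bar>t * Z \<omega>\<bar>))" for \<omega>
    using sums_split_initial_segment[OF sums[of \<omega>], of 2] by (simp add: f_def numeral_2_eq_2)
  have geo: "(\<lambda>r. x ^ 2 * x ^ r) sums (x ^ 2 * (1 / (1 - x)))"
    using x by (intro sums_mult geometric_sums) auto
  have geo': "summable (\<lambda>r. x ^ 2 * x ^ r)" using geo by (rule sums_summable)
  have nE: "norm (expectation (\<lambda>\<omega>. norm (f r \<omega>))) \<le> x ^ 2 * x ^ r" for r
    using fE[of r] f0 by (simp add: abs_of_nonneg integral_nonneg)
  have summ: "summable (\<lambda>r. expectation (\<lambda>\<omega>. norm (f r \<omega>)))"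
    using nE by (rule summable_comparison_test'[OF geo'])
  have AEs: "AE \<omega> in M. summable (\<lambda>r. norm (f r \<omega>))"
    using fsum f0 by (intro AE_I2) (simp add: abs_of_nonneg sums_iff)
  define R where "R \<omega> = exp \<bar>t * Z \<omega>\<bar> - (1 + \<bar>t * Z \<omega>\<bar>)" for \<omega>
  have Req: "(\<Sum>r. f r \<omega>) = R \<omega>" for \<omega> using fsum[of \<omega>] by (simp add: R_def sums_iff)
  have Rint: "integrable M R"
    using integrable_suminf[OF fint AEs summ] by (simp add: Req)
  have "expectation R = (\<Sum>r. expectation (f r))"
    using integral_suminf[OF fint AEs summ] by (simp add: Req)
  also have "\<dots> \<le> (\<Sum>r. x ^ 2 * x ^ r)"
  proof (intro suminf_le fE geo')
    show "summable (\<lambda>r. expectation (f r))"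
      using summ f0 by (simp add: abs_of_nonneg)
  qed
  also have "\<dots> = x ^ 2 * (1 / (1 - x))" using geo by (simp add: sums_iff)
  also have "\<dots> \<le> x ^ 2 * 2" using x by (intro mult_left_mono) (auto simp: field_simps)
  also have "\<dots> = 2 * (t * b)\<^sup>2" by (simp add: x_def power_mult_distrib)
  finally have RE: "expectation R \<le> 2 * (t * b)\<^sup>2" .
  have Zint: "integrable M Z"
    by (rule Bochner_Integration.integrable_norm_cancel) (use mom(1)[of 1] in simp_all)
  \<comment> \<open>For a negative argument y the claim amounts to sinh y \<le> y, proved by the
    sign of a derivative.\<close>
  have pw: "exp (t * Z \<omega>) \<le> 1 + t * Z \<omega> + R \<omega>" for \<omega>
  proof (cases "0 \<le> t * Z \<omega>")
    case False
    have "exp y - y \<le> exp (- y) + y" if "y \<le> 0" for y :: real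
    proof -
      have "(\<lambda>y. exp (- y) + y - (exp y - y)) 0 \<le> (\<lambda>y. exp (- y) + y - (exp y - y)) y"
      proof (rule DERIV_nonpos_imp_nonincreasing[OF that])
        fix z :: real
        have "((\<lambda>y. exp (- y) + y - (exp y - y)) has_real_derivative - exp (- z) + 1 - (exp z - 1)) (at z)"
          by (auto intro!: derivative_eq_intros)
        moreover have "2 \<le> exp (- z) + exp z" using exp_ge_add_one_self[of z] exp_ge_add_one_self[of "- z"] by linarith
        ultimately show "\<exists>y. ((\<lambda>y. exp (- y) + y - (exp y - y)) has_real_derivative y) (at z) \<and> y \<le> 0" by force
      qed
      then show ?thesis by simp
    qed
    from this[of "t * Z \<omega>"] False show ?thesis by (simp add: R_def)
  qed (simp add: R_def)
  have int: "integrable M (\<lambda>\<omega>. 1 + t * Z \<omega> + R \<omega>)" using Zint Rint by simp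
  show int': "integrable M (\<lambda>\<omega>. exp (t * Z \<omega>))"
  proof (rule Bochner_Integration.integrable_bound[OF int])
    show "AE \<omega> in M. norm (exp (t * Z \<omega>)) \<le> norm (1 + t * Z \<omega> + R \<omega>)"
      using pw by (intro AE_I2) (simp add: order_trans[OF _ abs_ge_self])
  qed measurable
  have "expectation (\<lambda>\<omega>. exp (t * Z \<omega>)) \<le> expectation (\<lambda>\<omega>. 1 + t * Z \<omega> + R \<omega>)"
    using pw by (intro integral_mono int int')
  also have "\<dots> = 1 + t * expectation Z + expectation R" using Zint Rint by (simp add: prob_space)
  also have "\<dots> \<le> 1 + (t * expectation Z + 2 * (t * b)\<^sup>2)" using RE by simp
  also have "\<dots> \<le> exp (t * expectation Z + 2 * (t * b)\<^sup>2)" by (rule exp_ge_add_one_self)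
  finally show "expectation (\<lambda>\<omega>. exp (t * Z \<omega>)) \<le> exp (t * expectation Z + 2 * (t * b)\<^sup>2)" .
qed

lemma chernoff_sum:
  assumes ind: "indep_vars (\<lambda>_. borel) Z {..<n}" and t: "0 < t"
    and mgf: "\<And>i. i < n \<Longrightarrow> integrable M (\<lambda>\<omega>. exp (t * Z i \<omega>))"
      "\<And>i. i < n \<Longrightarrow> expectation (\<lambda>\<omega>. exp (t * Z i \<omega>)) \<le> exp c"
  shows "prob {\<omega> \<in> space M. a \<le> (\<Sum>i<n. Z i \<omega>)} \<le> exp (real n * c - t * a)"
proof -
  have ind': "indep_vars (\<lambda>_. borel) (\<lambda>i \<omega>. exp (t * Z i \<omega>)) {..<n}"
    by (rule indep_vars_compose2[OF ind]) auto
  have exp_eq: "exp (t * (\<Sum>i<n. Z i \<omega>)) = (\<Prod>i<n. exp (t * Z i \<omega>))" for \<omega>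
    by (simp add: sum_distrib_left exp_sum)
  have int: "integrable M (\<lambda>\<omega>. exp (t * (\<Sum>i<n. Z i \<omega>)))"
    unfolding exp_eq using mgf(1) by (intro indep_vars_integrable[OF _ ind']) auto
  have "{\<omega> \<in> space M. a \<le> (\<Sum>i<n. Z i \<omega>)} = {\<omega> \<in> space M. exp (t * a) \<le> exp (t * (\<Sum>i<n. Z i \<omega>))}"
    using t by simp
  also have "prob \<dots> \<le> expectation (\<lambda>\<omega>. exp (t * (\<Sum>i<n. Z i \<omega>))) / exp (t * a)"
    using int by (intro integral_Markov_inequality_measure[where A = "{}"]) auto
  also have "expectation (\<lambda>\<omega>. exp (t * (\<Sum>i<n. Z i \<omega>))) = (\<Prod>i<n. expectation (\<lambda>\<omega>. exp (t * Z i \<omega>)))"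
    unfolding exp_eq using mgf(1) by (intro indep_vars_lebesgue_integral[OF _ ind']) auto
  also have "\<dots> \<le> (\<Prod>i<n. exp c)"
    using mgf(2) by (intro prod_mono) (auto intro!: integral_nonneg)
  also have "\<dots> = exp (real n * c)" by (simp add: exp_of_nat_mult)
  finally show ?thesis by (simp add: exp_diff divide_right_mono)
qed

text \<open>By independence the moment generating functions multiply, so squared parameters
  add.\<close>

lemma sub_gaussian_linear_combination:
  fixes I :: "'i set"
  assumes I: "finite I" and ind: "indep_vars (\<lambda>_. borel) e I"
    and sg: "\<And>k. k \<in> I \<Longrightarrow> sub_gaussian g (e k)"
  shows "sub_gaussian (g * sqrt (\<Sum>k\<in>I. (c k)\<^sup>2)) (\<lambda>\<omega>. \<Sum>k\<in>I. c k * e k \<omega>)"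
  unfolding sub_gaussian_def
proof (intro allI conjI)
  fix t :: real
  have ind': "indep_vars (\<lambda>_. borel) (\<lambda>k \<omega>. exp (t * c k * e k \<omega>)) I"
    by (rule indep_vars_compose2[OF ind]) auto
  have exp_eq: "exp (t * (\<Sum>k\<in>I. c k * e k \<omega>)) = (\<Prod>k\<in>I. exp (t * c k * e k \<omega>))" for \<omega>
    using I by (simp add: sum_distrib_left exp_sum mult.assoc)
  have mgf: "integrable M (\<lambda>\<omega>. exp (t * c k * e k \<omega>))"
    "expectation (\<lambda>\<omega>. exp (t * c k * e k \<omega>)) \<le> exp (g\<^sup>2 * (t * c k)\<^sup>2 / 2)" if "k \<in> I" for k
    using sg[OF that] by (auto simp: sub_gaussian_def)
  show "integrable M (\<lambda>\<omega>. exp (t * (\<Sum>k\<in>I. c k * e k \<omega>)))"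
    unfolding exp_eq using mgf(1) by (intro indep_vars_integrable[OF I ind']) auto
  have "expectation (\<lambda>\<omega>. exp (t * (\<Sum>k\<in>I. c k * e k \<omega>))) = (\<Prod>k\<in>I. expectation (\<lambda>\<omega>. exp (t * c k * e k \<omega>)))"
    unfolding exp_eq using mgf(1) by (intro indep_vars_lebesgue_integral[OF I ind']) auto
  also have "\<dots> \<le> (\<Prod>k\<in>I. exp (g\<^sup>2 * (t * c k)\<^sup>2 / 2))"
    using mgf(2) by (intro prod_mono) (auto intro!: integral_nonneg)
  also have "\<dots> = exp (\<Sum>k\<in>I. g\<^sup>2 * (t * c k)\<^sup>2 / 2)" using I by (rule exp_sum[symmetric])
  also have "(\<Sum>k\<in>I. g\<^sup>2 * (t * c k)\<^sup>2 / 2) = (g * sqrt (\<Sum>k\<in>I. (c k)\<^sup>2))\<^sup>2 * t\<^sup>2 / 2"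
    by (simp add: power_mult_distrib sum_nonneg sum_distrib_left sum_distrib_right sum_divide_distrib mult_ac)
  finally show "expectation (\<lambda>\<omega>. exp (t * (\<Sum>k\<in>I. c k * e k \<omega>)))
      \<le> exp ((g * sqrt (\<Sum>k\<in>I. (c k)\<^sup>2))\<^sup>2 * t\<^sup>2 / 2)" .
qed

end

section \<open>Distribution of the structural equation model\<close>

context total_effects
begin

text \<open>Deterministic, to be applied outcome by outcome. Induction on the rank substitutes the
  solved parents into the equation of \<open>j\<close>, and the recursion for \<open>P\<close>
  collects the coefficients.\<close>

lemma solve_structural_equations:
  assumes eq: "\<And>j. j < p \<Longrightarrow> x j = (\<Sum>k\<in>{..<p} - {j}. B $$ (j, k) * x k) + e j"
    and j: "j < p"
  shows "x j = (\<Sum>k<p. P j k * e k)"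
  using j
proof (induction "r j" arbitrary: j rule: less_induct)
  case less
  have "x j = (\<Sum>l\<in>{..<p} - {j}. B $$ (j, l) * x l) + e j" using eq less.prems by blast
  also have "(\<Sum>l\<in>{..<p} - {j}. B $$ (j, l) * x l)
      = (\<Sum>l\<in>{..<p} - {j}. B $$ (j, l) * (\<Sum>k<p. P l k * e k))"
  proof (intro sum.cong refl)
    fix l assume "l \<in> {..<p} - {j}"
    then show "B $$ (j, l) * x l = B $$ (j, l) * (\<Sum>k<p. P l k * e k)"
      using less.hyps[of l] parent_rank[OF less.prems, of l] by (cases "B $$ (j, l) = 0") auto
  qed
  also have "\<dots> = (\<Sum>l\<in>{..<p} - {j}. \<Sum>k<p. B $$ (j, l) * P l k * e k)"
    by (simp add: sum_distrib_left mult.assoc)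
  also have "\<dots> = (\<Sum>k<p. \<Sum>l\<in>{..<p} - {j}. B $$ (j, l) * P l k * e k)" by (rule sum.swap)
  also have "e j = (\<Sum>k<p. if j = k then e k else 0)" using less.prems by simp
  also have "(\<Sum>k<p. \<Sum>l\<in>{..<p} - {j}. B $$ (j, l) * P l k * e k) + (\<Sum>k<p. if j = k then e k else 0)
      = (\<Sum>k<p. P j k * e k)"
    unfolding sum.distrib[symmetric]
  proof (intro sum.cong refl)
    fix k
    show "(\<Sum>l\<in>{..<p} - {j}. B $$ (j, l) * P l k * e k) + (if j = k then e k else 0) = P j k * e k"
      unfolding effect_rec[OF less.prems, of k] by (simp add: algebra_simps sum_distrib_left)
  qed
  finally show ?case .
qed

lemma cov_diag_ge: "j < p \<Longrightarrow> \<sigma>\<^sup>2 \<le> cov \<sigma> j j"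
proof -
  assume j: "j < p"
  have "(P j j)\<^sup>2 \<le> (\<Sum>l<p. (P j l)\<^sup>2)"
    using j by (intro member_le_sum[of j "{..<p}" "\<lambda>l. (P j l)\<^sup>2"]) auto
  then have "\<sigma>\<^sup>2 * 1 \<le> \<sigma>\<^sup>2 * (\<Sum>l<p. (P j l)\<^sup>2)"
    using effect_diag[OF j] by (intro mult_left_mono) auto
  then show ?thesis by (simp add: cov_def power2_eq_square)
qed

end

lemma (in prob_space) noise_second_moment:
  assumes noise: "equal_variance_noise p \<sigma> e" and kl: "k < p" "l < p"
  shows "integrable M (\<lambda>\<omega>. e k \<omega> * e l \<omega>)"
    and "expectation (\<lambda>\<omega>. e k \<omega> * e l \<omega>) = (if k = l then \<sigma>\<^sup>2 else 0)"
proof -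
  have ind: "indep_vars (\<lambda>_. borel) e {..<p}"
    and e: "\<And>j. j < p \<Longrightarrow> integrable M (e j)" "\<And>j. j < p \<Longrightarrow> expectation (e j) = 0"
      "\<And>j. j < p \<Longrightarrow> integrable M (\<lambda>\<omega>. (e j \<omega>)\<^sup>2)" "\<And>j. j < p \<Longrightarrow> variance (e j) = \<sigma>\<^sup>2"
    using noise by (auto simp: equal_variance_noise_def)
  have "integrable M (\<lambda>\<omega>. e k \<omega> * e l \<omega>) \<and>
    expectation (\<lambda>\<omega>. e k \<omega> * e l \<omega>) = (if k = l then \<sigma>\<^sup>2 else 0)"
  proof (cases "k = l")
    case True
    then show ?thesis using e[OF kl(1)] by (simp add: power2_eq_square)
  next
    case False
    have ind': "indep_vars (\<lambda>_. borel) e {k, l}"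
      using ind kl by (elim indep_vars_subset) auto
    have int: "integrable M (e i)" if "i \<in> {k, l}" for i using that e(1) kl by auto
    show ?thesis
      using indep_vars_integrable[OF _ ind' int] indep_vars_lebesgue_integral[OF _ ind' int]
        False e(2)[OF kl(1)] by simp
  qed
  then show "integrable M (\<lambda>\<omega>. e k \<omega> * e l \<omega>)"
    and "expectation (\<lambda>\<omega>. e k \<omega> * e l \<omega>) = (if k = l then \<sigma>\<^sup>2 else 0)" by auto
qed

text \<open>The case \<open>r = 1\<close> of the even moment bound. It later keeps the deviation
  level in the range allowed by the Chernoff argument.\<close>

lemma (in prob_space) noise_variance_le:
  assumes noise: "equal_variance_noise p \<sigma> e" and sg: "sub_gaussian \<gamma> (e j)" and "0 < \<gamma>" and j: "j < p"
  shows "\<sigma>\<^sup>2 \<le> 6 * \<gamma>\<^sup>2"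
proof -
  have "random_variable borel (e j)"
    using noise j by (auto simp: equal_variance_noise_def borel_measurable_integrable)
  from sub_gaussian_even_moment(2)[OF sg \<open>0 < \<gamma>\<close> this, of 1]
  show ?thesis using noise_second_moment(2)[OF noise j j] by (simp add: power2_eq_square)
qed

lemma (in prob_space) sub_gaussian_cong_AE:
  assumes "AE \<omega> in M. U \<omega> = V \<omega>" "sub_gaussian g V"
    and [measurable]: "random_variable borel U" "random_variable borel V"
  shows "sub_gaussian g U"
  unfolding sub_gaussian_def
proof (intro allI conjI)
  fix t
  have ae: "AE \<omega> in M. exp (t * U \<omega>) = exp (t * V \<omega>)" using assms(1) by eventually_elim simp
  have V: "integrable M (\<lambda>\<omega>. exp (t * V \<omega>))" "expectation (\<lambda>\<omega>. exp (t * V \<omega>)) \<le> exp (g\<^sup>2 * t\<^sup>2 / 2)"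
    using assms(2) by (auto simp: sub_gaussian_def)
  show "integrable M (\<lambda>\<omega>. exp (t * U \<omega>))"
    using integrable_cong_AE[THEN iffD2, OF _ _ ae V(1)] by simp
  show "expectation (\<lambda>\<omega>. exp (t * U \<omega>)) \<le> exp (g\<^sup>2 * t\<^sup>2 / 2)"
    using integral_cong_AE[OF _ _ ae] V(2) by simp
qed

lemma measurable_vec_component:
  assumes "X \<in> M \<rightarrow>\<^sub>M vec_space p" "j < p"
  shows "(\<lambda>\<omega>. X \<omega> j) \<in> borel_measurable M"
  using measurable_compose[OF assms(1) measurable_component_singleton[of j "{..<p}"]] assms(2) by simp

text \<open>The finitely many almost sure equations hold simultaneously almost surely, and there
  \<open>X\<close> is \<open>P\<close> applied to the noise. Second moments follow since distinct
  noises are uncorrelated, sub-Gaussianity from independence.\<close>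

lemma (in prob_space) sem_distribution:
  assumes eff: "total_effects p B P r"
    and noise: "equal_variance_noise p \<sigma> e" and sg: "\<forall>j<p. sub_gaussian \<gamma> (e j)"
    and sem: "solves_sem p B e X"
  shows "total_effects.is_cov p P \<sigma> (second_moment_mat p X)"
    and "\<And>j. j < p \<Longrightarrow> sub_gaussian (\<gamma> * sqrt (\<Sum>k<p. (P j k)\<^sup>2)) (\<lambda>\<omega>. X \<omega> j)"
proof -
  interpret total_effects p B P r by (fact eff)
  have X: "random_variable (vec_space p) X" using sem by (simp add: solves_sem_def)
  note Xj = measurable_vec_component[OF X]
  have ind: "indep_vars (\<lambda>_. borel) e {..<p}" using noise by (simp add: equal_variance_noise_def)
  have ej[measurable]: "random_variable borel (e k)" if "k < p" for k
    using noise that by (auto simp: equal_variance_noise_def borel_measurable_integrable)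
  define U where "U j \<omega> = (\<Sum>k<p. P j k * e k \<omega>)" for j \<omega>
  have Um: "random_variable borel (U j)" for j
    unfolding U_def by (intro borel_measurable_sum borel_measurable_times borel_measurable_const ej) auto
  have "AE \<omega> in M. \<forall>j\<in>{..<p}. X \<omega> j = (\<Sum>k\<in>{..<p} - {j}. B $$ (j, k) * X \<omega> k) + e j \<omega>"
    using sem by (intro AE_finite_allI) (auto simp: solves_sem_def)
  then have rep: "AE \<omega> in M. \<forall>j\<in>{..<p}. X \<omega> j = U j \<omega>"
  proof eventually_elim
    case (elim \<omega>)
    show ?case
      unfolding U_def
    proof
      fix j assume "j \<in> {..<p}"
      show "X \<omega> j = (\<Sum>k<p. P j k * e k \<omega>)"
        by (rule solve_structural_equations) (use elim \<open>j \<in> {..<p}\<close> in \<open>simp_all only: lessThan_iff\<close>)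
    qed
  qed
  show "sub_gaussian (\<gamma> * sqrt (\<Sum>k<p. (P j k)\<^sup>2)) (\<lambda>\<omega>. X \<omega> j)" if j: "j < p" for j
  proof (rule sub_gaussian_cong_AE[OF _ _ Xj[OF j] Um])
    show "AE \<omega> in M. X \<omega> j = U j \<omega>" using rep by eventually_elim (use j in auto)
    show "sub_gaussian (\<gamma> * sqrt (\<Sum>k<p. (P j k)\<^sup>2)) (U j)"
      unfolding U_def using sg ind by (intro sub_gaussian_linear_combination) auto
  qed
  have "expectation (\<lambda>\<omega>. X \<omega> j * X \<omega> k) = cov \<sigma> j k" if jk: "j < p" "k < p" for j k
  proof -
    have int: "integrable M (\<lambda>\<omega>. (P j l * P k m) * (e l \<omega> * e m \<omega>))" if "l < p" "m < p" for l m
      using noise_second_moment(1)[OF noise that] by simp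
    have "expectation (\<lambda>\<omega>. X \<omega> j * X \<omega> k) = expectation (\<lambda>\<omega>. U j \<omega> * U k \<omega>)"
    proof (rule integral_cong_AE)
      show "AE \<omega> in M. X \<omega> j * X \<omega> k = U j \<omega> * U k \<omega>" using rep by eventually_elim (use jk in auto)
    qed (use Xj jk Um in auto)
    also have "\<dots> = expectation (\<lambda>\<omega>. \<Sum>l<p. \<Sum>m<p. (P j l * P k m) * (e l \<omega> * e m \<omega>))"
      by (simp add: U_def sum_product mult_ac)
    also have "\<dots> = (\<Sum>l<p. \<Sum>m<p. expectation (\<lambda>\<omega>. (P j l * P k m) * (e l \<omega> * e m \<omega>)))"
    proof -
      have "expectation (\<lambda>\<omega>. \<Sum>l<p. \<Sum>m<p. (P j l * P k m) * (e l \<omega> * e m \<omega>))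
          = (\<Sum>l<p. expectation (\<lambda>\<omega>. \<Sum>m<p. (P j l * P k m) * (e l \<omega> * e m \<omega>)))"
        using int by (intro Bochner_Integration.integral_sum Bochner_Integration.integrable_sum) auto
      also have "\<dots> = (\<Sum>l<p. \<Sum>m<p. expectation (\<lambda>\<omega>. (P j l * P k m) * (e l \<omega> * e m \<omega>)))"
        using int by (intro sum.cong refl Bochner_Integration.integral_sum) auto
      finally show ?thesis .
    qed
    also have "\<dots> = (\<Sum>l<p. \<Sum>m<p. if l = m then (P j l * P k m) * \<sigma>\<^sup>2 else 0)"
      using noise_second_moment(2)[OF noise] by (intro sum.cong refl) auto
    also have "\<dots> = cov \<sigma> j k" by (simp add: cov_def sum_distrib_left mult_ac)
    finally show ?thesis .
  qed
  then show "is_cov \<sigma> (second_moment_mat p X)"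
    by (simp add: is_cov_def second_moment_mat_def)
qed

section \<open>Entrywise concentration of the sample covariance\<close>

text \<open>Chernoff bounds for the sum and for its negative. The moment generating function is
  bounded for \<open>X\<close> on \<open>N\<close> and carried to the copies on \<open>M\<close> by
  equality in distribution.\<close>

lemma iid_product_concentration:
  fixes N :: "'a measure" and M :: "'b measure"
  assumes N: "prob_space N" and M: "prob_space M"
    and X: "X \<in> N \<rightarrow>\<^sub>M vec_space p"
    and copies: "prob_space.iid_copies M p n Y N X"
    and jk: "j < p" "k < p" and g: "0 < g"
    and sg: "prob_space.sub_gaussian N g (\<lambda>\<omega>. X \<omega> j)" "prob_space.sub_gaussian N g (\<lambda>\<omega>. X \<omega> k)"
    and x: "0 < x" "x \<le> 12 * g\<^sup>2" and n: "0 < n"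
  shows "measure M {\<omega> \<in> space M. x \<le> \<bar>(1 / real n) * (\<Sum>i<n. Y i \<omega> j * Y i \<omega> k)
      - integral\<^sup>L N (\<lambda>\<omega>. X \<omega> j * X \<omega> k)\<bar>} \<le> 2 * exp (- (real n * x\<^sup>2 / (288 * g ^ 4)))"
proof -
  interpret N: prob_space N by (fact N)
  interpret M: prob_space M by (fact M)
  note meas = measurable_vec_component[OF X]
  define \<mu> where "\<mu> = N.expectation (\<lambda>\<omega>. X \<omega> j * X \<omega> k)"
  define Z where "Z i \<omega> = Y i \<omega> j * Y i \<omega> k" for i \<omega>
  \<comment> \<open>This \<open>t\<close> minimizes \<open>72 * t\<^sup>2 * g ^ 4 - t * x\<close>,
    and \<open>x \<le> 12 * g\<^sup>2\<close> is exactly what makes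
    \<open>t * (6 * g\<^sup>2) \<le> 1 / 2\<close>.\<close>
  define t where "t = x / (144 * g ^ 4)"
  have t: "0 < t" using x g by (simp add: t_def)
  have b: "\<bar>s\<bar> * (6 * g\<^sup>2) \<le> 1 / 2" if "\<bar>s\<bar> = t" for s
  proof -
    have "t * (6 * g\<^sup>2) = x / (24 * g\<^sup>2)"
      using g by (simp add: t_def power2_eq_square power4_eq_xxxx field_simps)
    also have "\<dots> \<le> 1 / 2" using x g by (simp add: field_simps)
    finally show ?thesis using that by simp
  qed
  have b2: "2 * (s * (6 * g\<^sup>2))\<^sup>2 = 72 * t\<^sup>2 * g ^ 4" if "\<bar>s\<bar> = t" for s
  proof -
    have "s\<^sup>2 = t\<^sup>2" using that by (metis power2_abs)
    then show ?thesis by (simp add: power_mult_distrib flip: power_mult)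
  qed
  have [measurable]: "(\<lambda>v. v j * v k) \<in> borel_measurable (vec_space p)"
    using jk by (intro borel_measurable_times measurable_component_singleton) auto
  have ind: "M.indep_vars (\<lambda>_. vec_space p) Y {..<n}"
    and distr: "\<And>i. i < n \<Longrightarrow> distr M (vec_space p) (Y i) = distr N (vec_space p) X"
    using copies by (auto simp: M.iid_copies_def)
  have Ym[measurable]: "Y i \<in> M \<rightarrow>\<^sub>M vec_space p" if "i < n" for i
    using ind that by (auto simp: M.indep_vars_def)
  have ZX: "integrable M (\<lambda>\<omega>. exp (s * Z i \<omega>))"
    "M.expectation (\<lambda>\<omega>. exp (s * Z i \<omega>)) \<le> exp (s * \<mu> + 72 * t\<^sup>2 * g ^ 4)"
    if i: "i < n" and s: "\<bar>s\<bar> = t" for i s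
  proof -
    let ?f = "\<lambda>v :: nat \<Rightarrow> real. exp (s * (v j * v k))"
    have f: "?f \<in> borel_measurable (vec_space p)" by measurable
    have mom: "integrable N (\<lambda>\<omega>. \<bar>X \<omega> j * X \<omega> k\<bar> ^ r)"
      "N.expectation (\<lambda>\<omega>. \<bar>X \<omega> j * X \<omega> k\<bar> ^ r) \<le> fact r * (6 * g\<^sup>2) ^ r" for r
      using N.sub_gaussian_product_moment[OF sg(1) meas[OF jk(1)] sg(2) meas[OF jk(2)] g] by auto
    have mgf: "integrable N (\<lambda>\<omega>. exp (s * (X \<omega> j * X \<omega> k)))"
      "N.expectation (\<lambda>\<omega>. exp (s * (X \<omega> j * X \<omega> k))) \<le> exp (s * \<mu> + 2 * (s * (6 * g\<^sup>2))\<^sup>2)"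
      unfolding \<mu>_def using N.mgf_bound_of_moments[OF mom _ _ b[OF s]] meas jk by auto
    have "integrable (distr M (vec_space p) (Y i)) ?f"
      unfolding distr[OF i] using mgf(1) by (simp add: integrable_distr_eq[OF X f])
    then show "integrable M (\<lambda>\<omega>. exp (s * Z i \<omega>))"
      by (simp add: integrable_distr_eq[OF Ym[OF i] f] Z_def)
    have "M.expectation (\<lambda>\<omega>. exp (s * Z i \<omega>)) = integral\<^sup>L (distr M (vec_space p) (Y i)) ?f"
      by (simp add: integral_distr[OF Ym[OF i] f] Z_def)
    also have "\<dots> = N.expectation (\<lambda>\<omega>. exp (s * (X \<omega> j * X \<omega> k)))"
      unfolding distr[OF i] by (simp add: integral_distr[OF X f])
    finally show "M.expectation (\<lambda>\<omega>. exp (s * Z i \<omega>)) \<le> exp (s * \<mu> + 72 * t\<^sup>2 * g ^ 4)"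
      using mgf(2) by (simp add: b2[OF s])
  qed
  \<comment> \<open>One identity for both tails: \<open>s / t\<close> is 1 for the upper tail and -1
    for the lower one.\<close>
  have exponent: "real n * (s * \<mu> + 72 * t\<^sup>2 * g ^ 4) - t * (real n * ((s / t) * \<mu> + x))
      = - (real n * x\<^sup>2 / (288 * g ^ 4))" for s
  proof -
    have "72 * t\<^sup>2 * g ^ 4 - t * x = - (x\<^sup>2 / (288 * g ^ 4))"
      using g by (simp add: t_def power2_eq_square field_simps)
    then have "real n * (72 * t\<^sup>2 * g ^ 4 - t * x) = - (real n * x\<^sup>2 / (288 * g ^ 4))" by simp
    then show ?thesis using t by (simp add: algebra_simps)
  qed
  have indZ: "M.indep_vars (\<lambda>_. borel) Z {..<n}"
    unfolding Z_def by (rule M.indep_vars_compose2[OF ind, where Y = "\<lambda>_ v. v j * v k"]) measurable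
  have indZ': "M.indep_vars (\<lambda>_. borel) (\<lambda>i \<omega>. - Z i \<omega>) {..<n}"
    by (rule M.indep_vars_compose2[OF indZ, where Y = "\<lambda>_ v. - v"]) measurable
  have upper: "M.prob {\<omega> \<in> space M. real n * (\<mu> + x) \<le> (\<Sum>i<n. Z i \<omega>)} \<le> exp (- (real n * x\<^sup>2 / (288 * g ^ 4)))"
    using M.chernoff_sum[OF indZ t ZX, of "real n * (\<mu> + x)"] exponent[of t] t by simp
  have lower: "M.prob {\<omega> \<in> space M. real n * (- \<mu> + x) \<le> (\<Sum>i<n. - Z i \<omega>)} \<le> exp (- (real n * x\<^sup>2 / (288 * g ^ 4)))"
    using M.chernoff_sum[OF indZ' t, of "- t * \<mu> + 72 * t\<^sup>2 * g ^ 4" "real n * (- \<mu> + x)"]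
      ZX[of _ "- t"] exponent[of "- t"] t by simp
  have Zm: "Z i \<in> borel_measurable M" if "i < n" for i
    using indZ that by (auto simp: M.indep_vars_def)
  have Sm[measurable]: "(\<lambda>\<omega>. \<Sum>i<n. Z i \<omega>) \<in> borel_measurable M"
    using Zm by (intro borel_measurable_sum) auto
  have Sm'[measurable]: "(\<lambda>\<omega>. \<Sum>i<n. - Z i \<omega>) \<in> borel_measurable M"
    using Zm by (intro borel_measurable_sum borel_measurable_uminus) auto
  have "{\<omega> \<in> space M. x \<le> \<bar>(1 / real n) * (\<Sum>i<n. Z i \<omega>) - \<mu>\<bar>}
      \<subseteq> {\<omega> \<in> space M. real n * (\<mu> + x) \<le> (\<Sum>i<n. Z i \<omega>)}
        \<union> {\<omega> \<in> space M. real n * (- \<mu> + x) \<le> (\<Sum>i<n. - Z i \<omega>)}"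
    using n by (auto simp: abs_if sum_negf field_simps split: if_splits)
  then have "M.prob {\<omega> \<in> space M. x \<le> \<bar>(1 / real n) * (\<Sum>i<n. Z i \<omega>) - \<mu>\<bar>}
      \<le> M.prob ({\<omega> \<in> space M. real n * (\<mu> + x) \<le> (\<Sum>i<n. Z i \<omega>)}
        \<union> {\<omega> \<in> space M. real n * (- \<mu> + x) \<le> (\<Sum>i<n. - Z i \<omega>)})"
    by (intro M.finite_measure_mono) measurable
  also have "\<dots> \<le> M.prob {\<omega> \<in> space M. real n * (\<mu> + x) \<le> (\<Sum>i<n. Z i \<omega>)}
      + M.prob {\<omega> \<in> space M. real n * (- \<mu> + x) \<le> (\<Sum>i<n. - Z i \<omega>)}"
    by (intro measure_Un_le) measurable
  also have "\<dots> \<le> 2 * exp (- (real n * x\<^sup>2 / (288 * g ^ 4)))" using upper lower by simp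
  finally show ?thesis by (simp add: Z_def \<mu>_def)
qed

lemma sample_cov_carrier: "sample_cov p n Y \<omega> \<in> carrier_mat p p"
  by (simp add: sample_cov_def)

lemma sample_cov_index:
  "j < p \<Longrightarrow> k < p \<Longrightarrow> sample_cov p n Y \<omega> $$ (j, k) = (1 / real n) * (\<Sum>i<n. Y i \<omega> j * Y i \<omega> k)"
  by (simp add: sample_cov_def)

text \<open>Ties and singular matrices are covered by letting \<open>\<theta>\<close> be any
  measurable selection of permitted outputs and \<open>d\<close> any function.\<close>

theorem theorem3:
  fixes N :: "'a measure" and M :: "'b measure"
    and X :: "'a \<Rightarrow> nat \<Rightarrow> real"
    and Y :: "nat \<Rightarrow> 'b \<Rightarrow> nat \<Rightarrow> real"
    and B \<Sigma> :: "real mat"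
    and p q n :: nat
    and \<sigma> \<gamma> \<zeta> lam_min \<epsilon> :: real
    and d :: "real mat \<Rightarrow> nat set \<Rightarrow> nat \<Rightarrow> real"
    and \<theta> :: "'b \<Rightarrow> nat list"
  assumes "prob_space N" and "prob_space M"
    and model: "prob_space.equal_variance_sem N p B \<sigma> \<gamma> X"
    and dag: "acyclic (edges p B)"
    and q: "q < p" and in_degree: "\<forall>j<p. in_deg p B j \<le> q"
    and zeta: "is_min_edge_strength p B \<zeta>"
    and Sigma: "\<Sigma> = prob_space.second_moment_mat N p X"
    and lam_min: "0 < lam_min"
      "\<forall>S. S \<subseteq> {..<p} \<and> card S = q + 1 \<longrightarrow> lam_min \<le> min_eigenvalue (submatrix \<Sigma> S S)"
    and eps: "0 < \<epsilon>"
    and copies: "prob_space.iid_copies M p n Y N X"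
    and sample_size: "real n >
      (real q + 1)\<^sup>2 * (ln ((real p)\<^sup>2 + real p) - ln (\<epsilon> / 2)) * 128 * (1 + 4 * (\<gamma>\<^sup>2 / \<sigma>\<^sup>2))\<^sup>2 *
      (Max ((\<lambda>j. \<Sigma> $$ (j, j)) ` {..<p}))\<^sup>2 *
      ((\<zeta> * lam_min + 2 * \<sigma>\<^sup>2) / (\<zeta> * lam_min\<^sup>2))\<^sup>2"
    and random_output: "\<theta> \<in> M \<rightarrow>\<^sub>M count_space UNIV"
    and run: "\<forall>\<omega>\<in>space M.
      topological_ordering_output p (crit_f2 d q) (sample_cov p n Y \<omega>) (\<theta> \<omega>)"
  shows "measure M {\<omega> \<in> space M. topological_ordering p B (\<theta> \<omega>)} \<ge> 1 - \<epsilon>"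
\<comment> \<open>For \<open>\<epsilon> \<ge> 1\<close> the claim is trivial; otherwise the
  logarithmic factor is positive, which also forces \<open>0 < n\<close>.\<close>
proof (cases "\<epsilon> < 1")
  case False
  then have "1 - \<epsilon> \<le> 0" by simp
  also have "0 \<le> measure M {\<omega> \<in> space M. topological_ordering p B (\<theta> \<omega>)}" by simp
  finally show ?thesis .
next
  case True
  interpret N: prob_space N by fact
  interpret M: prob_space M by fact
  obtain e where noise: "N.equal_variance_noise p \<sigma> e" and sg: "\<forall>j<p. N.sub_gaussian \<gamma> (e j)"
    and sem: "N.solves_sem p B e X" and \<sigma>: "0 < \<sigma>" and \<gamma>: "0 < \<gamma>"
    using model by (auto simp: N.equal_variance_sem_def)
  have X: "X \<in> N \<rightarrow>\<^sub>M vec_space p" using sem by (simp add: N.solves_sem_def)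
  obtain P r where eff: "total_effects p B P r" using total_effects_exist[OF dag] .
  interpret total_effects p B P r by (fact eff)
  have p: "0 < p" using q by simp
  have cov: "is_cov \<sigma> \<Sigma>"
    unfolding Sigma by (rule N.sem_distribution(1)[OF eff noise sg sem])
  then have \<Sigma>: "\<Sigma> $$ (j, k) = cov \<sigma> j k" if "j < p" "k < p" for j k
    using that by (simp add: is_cov_def)
  note \<zeta> = min_edge_strength_bounds[OF zeta]
  have lam: "lam_min \<le> min_eigenvalue (submatrix \<Sigma> U U)" if "U \<subseteq> {..<p}" "card U = Suc q" for U
    using lam_min(2) that by simp
  have lam_le: "lam_min \<le> \<sigma>\<^sup>2"
    using lam_min(1) by (intro restricted_eigenvalue_le_noise_variance[OF cov q in_degree _ lam]) auto
  define m where "m = Max ((\<lambda>j. \<Sigma> $$ (j, j)) ` {..<p})"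
  have diag_le: "cov \<sigma> j j \<le> m" if "j < p" for j
    unfolding m_def using that \<Sigma> by (intro Max_ge) auto
  have m: "\<sigma>\<^sup>2 \<le> m" using cov_diag_ge[OF p] diag_le[OF p] by (rule order_trans)
  then have m0: "0 < m" using \<sigma> by (smt (verit) zero_less_power)
  define \<rho> where "\<rho> = \<gamma>\<^sup>2 / \<sigma>\<^sup>2"
  have \<rho>0: "0 < \<rho>" using \<sigma> \<gamma> by (simp add: \<rho>_def)
  \<comment> \<open>A common parameter for all coordinates: the squared norm of row \<open>j\<close>
    of \<open>P\<close> is \<open>cov \<sigma> j j / \<sigma>\<^sup>2\<close>, hence at most
    \<open>m / \<sigma>\<^sup>2\<close>.\<close>
  define g where "g = \<gamma> / \<sigma> * sqrt m"
  have g0: "0 < g" using \<sigma> \<gamma> m0 by (simp add: g_def)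
  have g2: "g\<^sup>2 = \<rho> * m" using m0 by (simp add: g_def \<rho>_def power_mult_distrib power_divide)
  have g4: "g ^ 4 = \<rho>\<^sup>2 * m\<^sup>2"
    using g2 by (metis power_mult_distrib power2_eq_square power4_eq_xxxx mult.assoc)
  have sgX: "N.sub_gaussian g (\<lambda>\<omega>. X \<omega> j)" if j: "j < p" for j
  proof (rule N.sub_gaussian_mono[OF N.sem_distribution(2)[OF eff noise sg sem j]])
    have "\<sigma>\<^sup>2 * (\<Sum>k<p. (P j k)\<^sup>2) \<le> m" using diag_le[OF j] by (simp add: cov_def power2_eq_square)
    then have "(\<Sum>k<p. (P j k)\<^sup>2) \<le> m / \<sigma>\<^sup>2" using \<sigma> by (simp add: field_simps)
    then have "sqrt (\<Sum>k<p. (P j k)\<^sup>2) \<le> sqrt m / \<sigma>"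
      using \<sigma> real_sqrt_le_mono by (fastforce simp: real_sqrt_divide)
    then have "\<gamma> * sqrt (\<Sum>k<p. (P j k)\<^sup>2) \<le> \<gamma> * (sqrt m / \<sigma>)"
      using \<gamma> by (intro mult_left_mono) auto
    then show "\<gamma> * sqrt (\<Sum>k<p. (P j k)\<^sup>2) \<le> g" by (simp add: g_def)
    show "0 \<le> \<gamma> * sqrt (\<Sum>k<p. (P j k)\<^sup>2)" using \<gamma> by (simp add: sum_nonneg)
  qed
  define D where "D = \<zeta> * lam_min + 2 * \<sigma>\<^sup>2"
  have D: "0 < D" using \<zeta>(1) lam_min(1) by (simp add: D_def add_pos_nonneg)
  define \<delta> where "\<delta> = \<zeta> * lam_min\<^sup>2 / ((real q + 1) * D)"
  have \<delta>0: "0 < \<delta>" using \<zeta>(1) lam_min(1) D by (simp add: \<delta>_def)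
  have "\<delta> \<le> lam_min"
  proof -
    have "\<zeta> * lam_min\<^sup>2 \<le> lam_min * D"
      using lam_min(1) by (simp add: D_def power2_eq_square[of lam_min] algebra_simps)
    also have "\<dots> \<le> lam_min * ((real q + 1) * D)"
      using lam_min(1) D by (intro mult_left_mono) (auto simp: algebra_simps)
    finally show ?thesis unfolding \<delta>_def using D by (intro divide_le_eq[THEN iffD2]) auto
  qed
  also note lam_le
  also note m
  also have "m \<le> 12 * g\<^sup>2"
  proof -
    have "\<sigma>\<^sup>2 \<le> 6 * \<gamma>\<^sup>2"
      using N.noise_variance_le[OF noise _ \<gamma> p] sg p by blast
    then have "\<sigma>\<^sup>2 \<le> 12 * \<gamma>\<^sup>2" using zero_le_power2[of \<gamma>] by linarith
    then have "1 \<le> 12 * \<rho>" using \<sigma> \<gamma> by (simp add: \<rho>_def field_simps)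
    then have "1 * m \<le> 12 * \<rho> * m" using m0 by (intro mult_right_mono) auto
    then show ?thesis by (simp add: g2)
  qed
  finally have \<delta>_le: "\<delta> \<le> 12 * g\<^sup>2" .
  define L where "L = ln ((real p)\<^sup>2 + real p) - ln (\<epsilon> / 2)"
  have pp: "2 \<le> (real p)\<^sup>2 + real p"
  proof -
    have "1 \<le> real p" using p by simp
    then show ?thesis using one_le_power[of "real p" 2] by linarith
  qed
  have L0: "0 < L"
    using pp True eps by (simp add: L_def ln_less_cancel_iff)
  have expL: "exp (- L) = \<epsilon> / 2 / ((real p)\<^sup>2 + real p)"
    using pp eps by (simp add: L_def exp_diff)
  \<comment> \<open>The hypothesis on \<open>n\<close> supplies
    \<open>128 * (1 + 4 * \<rho>)\<^sup>2\<close> where the tail bound asks for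
    \<open>288 * \<rho>\<^sup>2\<close>; the part \<open>128 * 16 * \<rho>\<^sup>2\<close> alone is
    larger.\<close>
  have size: "288 * g ^ 4 * L < real n * \<delta>\<^sup>2"
  proof -
    have "(4 * \<rho>)\<^sup>2 \<le> (1 + 4 * \<rho>)\<^sup>2" using \<rho>0 by (intro power_mono) auto
    then have "16 * \<rho>\<^sup>2 \<le> (1 + 4 * \<rho>)\<^sup>2" by (simp add: power_mult_distrib)
    then have "288 * \<rho>\<^sup>2 \<le> 128 * (1 + 4 * \<rho>)\<^sup>2" using zero_le_power2[of \<rho>] by linarith
    then have "288 * \<rho>\<^sup>2 * (m\<^sup>2 * L) \<le> 128 * (1 + 4 * \<rho>)\<^sup>2 * (m\<^sup>2 * L)"
      using L0 by (intro mult_right_mono) auto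
    then have "288 * g ^ 4 * L \<le> L * 128 * (1 + 4 * \<rho>)\<^sup>2 * m\<^sup>2"
      by (simp add: g4 mult_ac)
    also have "\<dots> = (real q + 1)\<^sup>2 * L * 128 * (1 + 4 * \<rho>)\<^sup>2 * m\<^sup>2 * (D / (\<zeta> * lam_min\<^sup>2))\<^sup>2 * \<delta>\<^sup>2"
    proof -
      have "(real q + 1) * (D / (\<zeta> * lam_min\<^sup>2)) * \<delta> = 1"
        using \<zeta>(1) lam_min(1) D by (simp add: \<delta>_def)
      then have "(real q + 1)\<^sup>2 * (D / (\<zeta> * lam_min\<^sup>2))\<^sup>2 * \<delta>\<^sup>2 = 1"
        by (metis power_mult_distrib power_one)
      then have "L * 128 * (1 + 4 * \<rho>)\<^sup>2 * m\<^sup>2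
          = L * 128 * (1 + 4 * \<rho>)\<^sup>2 * m\<^sup>2 * ((real q + 1)\<^sup>2 * (D / (\<zeta> * lam_min\<^sup>2))\<^sup>2 * \<delta>\<^sup>2)"
        by simp
      then show ?thesis by (simp only: mult_ac)
    qed
    also have "\<dots> < real n * \<delta>\<^sup>2"
      using sample_size \<delta>0 unfolding m_def[symmetric] L_def[symmetric] \<rho>_def[symmetric] D_def[symmetric]
      by (intro mult_strict_right_mono) auto
    finally show ?thesis .
  qed
  have n: "0 < n"
  proof (rule ccontr)
    assume "\<not> 0 < n"
    moreover have "0 < 288 * g ^ 4 * L" using g0 L0 by simp
    ultimately show False using size by simp
  qed
  have tail: "exp (- (real n * \<delta>\<^sup>2 / (288 * g ^ 4))) \<le> \<epsilon> / 2 / ((real p)\<^sup>2 + real p)"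
  proof -
    have "L \<le> real n * \<delta>\<^sup>2 / (288 * g ^ 4)"
      using size g0 by (simp add: pos_le_divide_eq mult.commute)
    then show ?thesis unfolding expL[symmetric] by simp
  qed
  define bad where "bad = (\<lambda>(j, k). {\<omega> \<in> space M. \<delta> \<le> \<bar>(1 / real n) * (\<Sum>i<n. Y i \<omega> j * Y i \<omega> k)
      - N.expectation (\<lambda>\<omega>. X \<omega> j * X \<omega> k)\<bar>})"
  have Ym: "Y i \<in> M \<rightarrow>\<^sub>M vec_space p" if "i < n" for i
    using copies that by (auto simp: M.iid_copies_def M.indep_vars_def)
  have bad_sets: "bad jk \<in> sets M" if pair: "jk \<in> {..<p} \<times> {..<p}" for jk
  proof -
    obtain j k where jk: "jk = (j, k)" "j < p" "k < p" using pair by (cases jk) auto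
    have [measurable]: "(\<lambda>\<omega>. \<Sum>i<n. Y i \<omega> j * Y i \<omega> k) \<in> borel_measurable M"
      using measurable_vec_component[OF Ym] jk by (intro borel_measurable_sum borel_measurable_times) auto
    show ?thesis unfolding bad_def jk(1) prod.case by measurable
  qed
  have bad_prob: "M.prob (bad jk) \<le> \<epsilon> / ((real p)\<^sup>2 + real p)" if pair: "jk \<in> {..<p} \<times> {..<p}" for jk
  proof -
    obtain j k where jk: "jk = (j, k)" "j < p" "k < p" using pair by (cases jk) auto
    have "M.prob (bad jk) \<le> 2 * exp (- (real n * \<delta>\<^sup>2 / (288 * g ^ 4)))"
      unfolding bad_def jk(1) prod.case
      by (rule iid_product_concentration[OF N.prob_space_axioms M.prob_space_axioms X copies
            jk(2,3) g0 sgX[OF jk(2)] sgX[OF jk(3)] \<delta>0 \<delta>_le n])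
    also have "\<dots> \<le> 2 * (\<epsilon> / 2 / ((real p)\<^sup>2 + real p))"
      using tail by (rule mult_left_mono) simp
    also have "\<dots> = \<epsilon> / ((real p)\<^sup>2 + real p)"
      unfolding times_divide_eq_right by (rule arg_cong[where f = "\<lambda>x. x / _"]) simp
    finally show ?thesis .
  qed
  let ?bad = "\<Union>jk\<in>{..<p} \<times> {..<p}. bad jk"
  let ?good = "{\<omega> \<in> space M. topological_ordering p B (\<theta> \<omega>)}"
  \<comment> \<open>Union bound over all \<open>p\<^sup>2\<close> ordered pairs; each costs at most
    \<open>\<epsilon> / (p\<^sup>2 + p)\<close>, so the total is at most
    \<open>\<epsilon>\<close>.\<close>
  have "M.prob ?bad \<le> (\<Sum>jk\<in>{..<p} \<times> {..<p}. M.prob (bad jk))"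
    using bad_sets by (intro measure_UNION_le) auto
  also have "\<dots> \<le> (\<Sum>jk\<in>{..<p} \<times> {..<p}. \<epsilon> / ((real p)\<^sup>2 + real p))"
    by (intro sum_mono bad_prob)
  also have "\<dots> = (real p)\<^sup>2 * (\<epsilon> / ((real p)\<^sup>2 + real p))"
    by (simp add: card_cartesian_product power2_eq_square)
  also have "\<dots> \<le> ((real p)\<^sup>2 + real p) * (\<epsilon> / ((real p)\<^sup>2 + real p))"
    using eps by (intro mult_right_mono) auto
  also have "\<dots> = \<epsilon>" using pp by simp
  finally have bad: "M.prob ?bad \<le> \<epsilon>" .
  have "space M - ?bad \<subseteq> ?good"
  proof
    fix \<omega> assume \<omega>: "\<omega> \<in> space M - ?bad"
    have "topological_ordering p B (\<theta> \<omega>)"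
    proof (rule algorithm_correct[OF cov q in_degree lam_min(1) lam \<zeta> sample_cov_carrier])
      show "topological_ordering_output p (crit_f2 d q) (sample_cov p n Y \<omega>) (\<theta> \<omega>)"
        using run \<omega> by simp
      show "sample_cov p n Y \<omega> $$ (i, k) = sample_cov p n Y \<omega> $$ (k, i)" if "i < p" "k < p" for i k
        using that by (simp add: sample_cov_index mult.commute)
      show "\<bar>sample_cov p n Y \<omega> $$ (i, k) - \<Sigma> $$ (i, k)\<bar>
          < \<zeta> * lam_min\<^sup>2 / ((real q + 1) * (\<zeta> * lam_min + 2 * \<sigma>\<^sup>2))" if "i < p" "k < p" for i k
      proof -
        have "\<omega> \<notin> bad (i, k)" using \<omega> that by blast
        then show ?thesis
          using \<omega> that by (simp add: bad_def sample_cov_index Sigma N.second_moment_mat_def \<delta>_def D_def not_le)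
      qed
    qed
    then show "\<omega> \<in> ?good" using \<omega> by simp
  qed
  \<comment> \<open>Measurability of \<open>\<theta>\<close> into the discrete space of lists makes
    the success event measurable.\<close>
  moreover have "?good \<in> sets M"
    using measurable_sets[OF random_output, of "{l. topological_ordering p B l}"]
    by (simp add: vimage_def Int_def conj_commute)
  ultimately have "M.prob (space M - ?bad) \<le> M.prob ?good"
    by (rule M.finite_measure_mono)
  moreover have "M.prob (space M - ?bad) = 1 - M.prob ?bad"
    using bad_sets by (intro M.prob_compl sets.finite_UN) auto
  ultimately show ?thesis using bad by linarith
qed

end
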